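(* Let $0<\kappa<1$ and let $$\Theta_\kappa=\begin{pmatrix}\mathbb{A}&K&1\\ \mathcal{H}_+\subset\mathcal{H}\subset\mathcal{H}_-& &\mathbb{C}\end{pmatrix}$$ be a minimal L-system with symmetric operator $\dot A$, with main operator $T$ having von Neumann parameter $\kappa$, and with impedance function $V_{\Theta_\kappa}(z)$ which is not an identical constant in $\mathbb{C}_+$. Let $\hat A$ be the quasi-kernel of $\operatorname{Re}\mathbb{A}$. Then the following are equivalent: (1) $V_{\Theta_\kappa}(z)$ belongs to the generalized Donoghue class $\mathfrak{M}_\kappa$ and $$V_{\Theta_\kappa}(z)=\frac{1-\kappa}{1+\kappa}\,V_{\Theta_0}(z),\qquad z\in\mathbb{C}_+,$$ where $V_{\Theta_0}(z)$ is the impedance function of an L-system $\Theta_0=\begin{pmatrix}\mathbb{A}_0&K_0&1\\ \mathcal{H}_+\subset\mathcal{H}\subset\mathcal{H}_-& &\mathbb{C}\end{pmatrix}$ with the same symmetric operator $\dot A$ and the same quasi-kernel $\hat A$ of $\operatorname{Re}\mathbb{A}_0$, whose main operator $T_0$ and $\hat A$ satisfy the Hypothesis (H) (see context) with the reference operator $A=\hat A$ and with von Neumann parameter $\kappa_0=0$ of $T_0$; (2) the triple $(\dot A,T,\hat A)$ satisfies the Hypothesis (H) with reference operator $A=\hat A$ and parameter $\kappa$.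
   Context: Rigged space. $\dot A$ is a closed densely defined symmetric operator with deficiency indices $(1,1)$ in a Hilbert space $\mathcal{H}$ with inner product $(\cdot,\cdot)$ (linear in the first argument). $\mathcal{H}_+=\mathrm{Dom}(\dot A^* )$ with $(f,g)_+=(f,g)+(\dot A^*f,\dot A^*g)$; $\mathcal{H}_-$ is the space dual to $\mathcal{H}_+$ with respect to $\mathcal{H}$, so $\mathcal{H}_+\subset\mathcal{H}\subset\mathcal{H}_-$, and $(u,f)$ denotes the value of $f\in\mathcal{H}_-$ at $u\in\mathcal{H}_+$ (equal to the $\mathcal{H}$-inner product if $f\in\mathcal{H}$). $[X,Y]$ is the set of bounded linear operators $X\to Y$. Spaces dual to $\mathcal{H}_\pm$ are identified with $\mathcal{H}_\mp$, so $\mathbb{A}\in[\mathcal{H}_+,\mathcal{H}_-]$ has adjoint $\mathbb{A}^*\in[\mathcal{H}_+,\mathcal{H}_-]$; $\operatorname{Re}\mathbb{A}=(\mathbb{A}+\mathbb{A}^* )/2$, $\operatorname{Im}\mathbb{A}=(\mathbb{A}-\mathbb{A}^* )/(2i)$. L-systems. For $\mathbb{B}=\mathbb{B}^*\in[\mathcal{H}_+,\mathcal{H}_-]$ with $\mathbb{B}\supset\dot A$, its quasi-kernel is the restriction of $\mathbb{B}$ to $\{f\in\mathcal{H}_+:\mathbb{B}f\in\mathcal{H}\}$; $\mathbb{B}$ is a t-self-adjoint bi-extension of $\dot A$ if its quasi-kernel is a self-adjoint operator in $\mathcal{H}$. The class $\Lambda(\dot A)$ consists of operators $T$ with $\dot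 A\subset T\subset\dot A^*$, $\rho(T)\neq\emptyset$ and $\mathrm{Dom}(\dot A)=\mathrm{Dom}(T)\cap\mathrm{Dom}(T^* )$. A $( * )$-extension of $T\in\Lambda(\dot A)$ is $\mathbb{A}\in[\mathcal{H}_+,\mathcal{H}_-]$ with $\dot A\subset T\subset\mathbb{A}$, $\dot A\subset T^*\subset\mathbb{A}^*$ such that $\operatorname{Re}\mathbb{A}$ is a t-self-adjoint bi-extension of $\dot A$. An array $\begin{pmatrix}\mathbb{A}&K&1\\ \mathcal{H}_+\subset\mathcal{H}\subset\mathcal{H}_-& &\mathbb{C}\end{pmatrix}$ is an L-system (with $E=\mathbb{C}$, $J=1$) if $\mathbb{A}$ is a $( * )$-extension of some $T\in\Lambda(\dot A)$, $K\in[\mathbb{C},\mathcal{H}_-]$, $K^*\in[\mathcal{H}_+,\mathbb{C}]$, $\operatorname{Im}\mathbb{A}=KK^*$ and $\mathrm{Ran}(K)=\mathrm{Ran}(\operatorname{Im}\mathbb{A})$. $T$, the restriction of $\mathbb{A}$ to $\{f\in\mathcal{H}_+:\mathbb{A}f\in\mathcal{H}\}$, is the main operator. The L-system is minimal if $\dot A$ is prime, i.e. there is no non-trivial subspace invariant for $\dot A$ on which the restriction of $\dot A$ is self-adjoint. With $\hat A$ the quasi-kernel of $\operatorname{Re}\mathbb{A}$, the impedance function of an L-system $\Theta$ is $V_\Theta(z)=K^*(\operatorname{Re}\mathbb{A}-zI)^{-1}K$, $z\in\rho(\hat A)$ (well defined since $\mathrm{Ran}(\operatorname{Re}\mathbb{A}-zI)\supset\mathrm{Ran}(K)$).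 Von Neumann parameter. $T\neq T^*$ is a maximal dissipative extension of $\dot A$ ($\operatorname{Im}(Tf,f)\ge0$ on $\mathrm{Dom}(T)$), and its von Neumann parameter is the number $\kappa$ such that $g_+-\kappa g_-\in\mathrm{Dom}(T)$, where $g_\pm\in\mathrm{Ker}(\dot A^*\mp iI)$, $\|g_\pm\|=1$; multiplying $g_-$ by a unimodular constant, one always takes $\kappa$ real with $0\le\kappa<1$. Hypothesis (H), for a triple $(\dot A,T,A)$ and a parameter $\kappa$: $T\ne T^*$ is a maximal dissipative extension of $\dot A$, $A$ is a self-adjoint (reference) extension of $\dot A$, and there are deficiency elements $g_\pm\in\mathrm{Ker}(\dot A^*\mp iI)$, $\|g_\pm\|=1$, such that simultaneously $g_+-g_-\in\mathrm{Dom}(A)$ and $g_+-\kappa g_-\in\mathrm{Dom}(T)$. Generalized Donoghue class. For $0\le\kappa<1$, $\mathfrak{M}_\kappa$ is the class of analytic maps $V:\mathbb{C}_+\to\mathbb{C}_+$ admitting a representation $V(z)=\int_{\mathbb{R}}\left(\frac{1}{\lambda-z}-\frac{\lambda}{1+\lambda^2}\right)d\mu(\lambda)$ with an infinite Borel measure $\mu$ (i.e. $\mu(\mathbb{R})=\infty$) such that $\int_{\mathbb{R}}\frac{d\mu(\lambda)}{1+\lambda^2}=\frac{1-\kappa}{1+\kappa}$ (equivalently $V(i)=i\frac{1-\kappa}{1+\kappa}$). *)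

theory Defs
  imports "HOL-Analysis.Analysis"
begin

section \<open>Complex Hilbert spaces\<close>

text \<open>The inner product is linear in the first argument.\<close>

class complex_hilbert = banach +
  fixes scaleC :: "complex \<Rightarrow> 'a \<Rightarrow> 'a" (infixr "*\<^sub>C" 75)
    and cinner :: "'a \<Rightarrow> 'a \<Rightarrow> complex"
  assumes scaleC_add_right: "c *\<^sub>C (x + y) = c *\<^sub>C x + c *\<^sub>C y"
    and scaleC_add_left: "(c + d) *\<^sub>C x = c *\<^sub>C x + d *\<^sub>C x"
    and scaleC_scaleC: "c *\<^sub>C d *\<^sub>C x = (c * d) *\<^sub>C x"
    and scaleC_one: "1 *\<^sub>C x = x"
    and scaleR_scaleC: "r *\<^sub>R x = complex_of_real r *\<^sub>C x"
    and cinner_add_left: "cinner (x + y) z = cinner x z + cinner y z"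
    and cinner_scaleC_left: "cinner (c *\<^sub>C x) y = c * cinner x y"
    and cinner_commute: "cinner x y = cnj (cinner y x)"
    and cinner_self: "cinner x x = complex_of_real ((norm x)\<^sup>2)"

lemma vector_space_scaleC: "vector_space (scaleC :: complex \<Rightarrow> 'a \<Rightarrow> 'a::complex_hilbert)"
  by unfold_locales
    (simp_all add: scaleC_add_right scaleC_add_left scaleC_scaleC scaleC_one)


section \<open>Unbounded operators\<close>

text \<open>An operator is represented by its graph, so that extension is inclusion
  and the domain is \<^const>\<open>Domain\<close>.\<close>

type_synonym 'a graph = "('a \<times> 'a) set"

definition linear_op :: "'a::complex_hilbert graph \<Rightarrow> bool" where
  "linear_op R \<longleftrightarrow> single_valued R \<and> (0, 0) \<in> R \<and>
    (\<forall>f h g k. (f, h) \<in> R \<longrightarrow> (g, k) \<in> R \<longrightarrow> (f + g, h + k) \<in> R) \<and>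
    (\<forall>c f h. (f, h) \<in> R \<longrightarrow> (c *\<^sub>C f, c *\<^sub>C h) \<in> R)"

definition op_apply :: "'a graph \<Rightarrow> 'a \<Rightarrow> 'a" where
  "op_apply R f = (THE h. (f, h) \<in> R)"

definition densely_defined :: "'a::complex_hilbert graph \<Rightarrow> bool" where
  "densely_defined R \<longleftrightarrow> closure (Domain R) = UNIV"

text \<open>Adjoints and self-adjointness of an operator acting in the closed subspace \<open>L\<close>;
  the case \<open>L = UNIV\<close> is the usual notion.\<close>

definition adjoint_in :: "'a set \<Rightarrow> 'a::complex_hilbert graph \<Rightarrow> 'a graph" where
  "adjoint_in L R = {(g, k). g \<in> L \<and> k \<in> L \<and> (\<forall>(f, h) \<in> R. cinner h g = cinner f k)}"

definition self_adjoint_in :: "'a set \<Rightarrow> 'a::complex_hilbert graph \<Rightarrow> bool" where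
  "self_adjoint_in L R \<longleftrightarrow> linear_op R \<and> R \<subseteq> L \<times> L \<and> L \<subseteq> closure (Domain R) \<and>
    adjoint_in L R = R"

abbreviation adjoint_op :: "'a::complex_hilbert graph \<Rightarrow> 'a graph" where
  "adjoint_op \<equiv> adjoint_in UNIV"

abbreviation self_adjoint :: "'a::complex_hilbert graph \<Rightarrow> bool" where
  "self_adjoint \<equiv> self_adjoint_in UNIV"

definition closed_symmetric :: "'a::complex_hilbert graph \<Rightarrow> bool" where
  "closed_symmetric S \<longleftrightarrow> linear_op S \<and> closed S \<and> densely_defined S \<and> S \<subseteq> adjoint_op S"

definition eigenspace :: "'a::complex_hilbert graph \<Rightarrow> complex \<Rightarrow> 'a set" where
  "eigenspace R z = {g. (g, z *\<^sub>C g) \<in> R}"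

text \<open>The dimension \<^const>\<open>vector_space.dim\<close> of an infinite-dimensional space is 0,
  so the equations below do say that both deficiency spaces are one-dimensional.\<close>

definition deficiency_one_one :: "'a::complex_hilbert graph \<Rightarrow> bool" where
  "deficiency_one_one S \<longleftrightarrow>
    vector_space.dim scaleC (eigenspace (adjoint_op S) \<i>) = 1 \<and>
    vector_space.dim scaleC (eigenspace (adjoint_op S) (- \<i>)) = 1"

definition prime_op :: "'a::complex_hilbert graph \<Rightarrow> bool" where
  "prime_op S \<longleftrightarrow> \<not> (\<exists>L. module.subspace scaleC L \<and> closed L \<and> L \<noteq> {0} \<and>
    (\<forall>(f, h) \<in> S. f \<in> L \<longrightarrow> h \<in> L) \<and>
    self_adjoint_in L {(f, h) \<in> S. f \<in> L})"

definition resolvent_set :: "'a::complex_hilbert graph \<Rightarrow> complex set" where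
  "resolvent_set R = {z. (\<forall>h. \<exists>!f. (f, h + z *\<^sub>C f) \<in> R) \<and>
    (\<exists>C. \<forall>(f, h) \<in> R. norm f \<le> C * norm (h - z *\<^sub>C f))}"

definition dissipative :: "'a::complex_hilbert graph \<Rightarrow> bool" where
  "dissipative T \<longleftrightarrow> linear_op T \<and> (\<forall>(f, h) \<in> T. 0 \<le> Im (cinner h f))"

definition max_dissipative_ext :: "'a::complex_hilbert graph \<Rightarrow> 'a graph \<Rightarrow> bool" where
  "max_dissipative_ext S T \<longleftrightarrow> S \<subseteq> T \<and> dissipative T \<and>
    (\<forall>T'. dissipative T' \<longrightarrow> T \<subseteq> T' \<longrightarrow> T' = T)"

definition deficiency_pair :: "'a::complex_hilbert graph \<Rightarrow> 'a \<Rightarrow> 'a \<Rightarrow> bool" where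
  "deficiency_pair S gp gm \<longleftrightarrow>
    gp \<in> eigenspace (adjoint_op S) \<i> \<and> norm gp = 1 \<and>
    gm \<in> eigenspace (adjoint_op S) (- \<i>) \<and> norm gm = 1"

definition von_neumann_parameter :: "'a::complex_hilbert graph \<Rightarrow> 'a graph \<Rightarrow> real \<Rightarrow> bool" where
  "von_neumann_parameter S T \<kappa> \<longleftrightarrow> T \<noteq> adjoint_op T \<and> max_dissipative_ext S T \<and>
    0 \<le> \<kappa> \<and> \<kappa> < 1 \<and>
    (\<exists>gp gm. deficiency_pair S gp gm \<and> gp - complex_of_real \<kappa> *\<^sub>C gm \<in> Domain T)"

definition hypothesis_H ::
    "'a::complex_hilbert graph \<Rightarrow> 'a graph \<Rightarrow> 'a graph \<Rightarrow> real \<Rightarrow> bool" where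
  "hypothesis_H S T A \<kappa> \<longleftrightarrow> T \<noteq> adjoint_op T \<and> max_dissipative_ext S T \<and>
    S \<subseteq> A \<and> self_adjoint A \<and>
    (\<exists>gp gm. deficiency_pair S gp gm \<and> gp - gm \<in> Domain A \<and>
      gp - complex_of_real \<kappa> *\<^sub>C gm \<in> Domain T)"


section \<open>The rigged space of a symmetric operator\<close>

definition Hplus :: "'a::complex_hilbert graph \<Rightarrow> 'a set" where
  "Hplus S = Domain (adjoint_op S)"

definition cinner_plus :: "'a::complex_hilbert graph \<Rightarrow> 'a \<Rightarrow> 'a \<Rightarrow> complex" where
  "cinner_plus S f g = cinner f g +
    cinner (op_apply (adjoint_op S) f) (op_apply (adjoint_op S) g)"

definition norm_plus :: "'a::complex_hilbert graph \<Rightarrow> 'a \<Rightarrow> real" where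
  "norm_plus S f = sqrt (Re (cinner_plus S f f))"

text \<open>An element \<open>F\<close> of the negative space is represented by the bounded antilinear functional
  \<open>u \<mapsto> (F, u)\<close> on the positive space, the complex conjugate of the value \<open>(u, F)\<close>;
  it is set to 0 off the positive space. With this choice
  the vector space structure is pointwise and the embedding of the Hilbert space is linear.\<close>

type_synonym 'a functional = "'a \<Rightarrow> complex"

definition Hminus :: "'a::complex_hilbert graph \<Rightarrow> 'a functional set" where
  "Hminus S = {F. (\<forall>u \<in> Hplus S. \<forall>v \<in> Hplus S. F (u + v) = F u + F v) \<and>
    (\<forall>c. \<forall>u \<in> Hplus S. F (c *\<^sub>C u) = cnj c * F u) \<and>
    (\<exists>C. \<forall>u \<in> Hplus S. cmod (F u) \<le> C * norm_plus S u) \<and>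
    (\<forall>u. u \<notin> Hplus S \<longrightarrow> F u = 0)}"

definition norm_minus :: "'a::complex_hilbert graph \<Rightarrow> 'a functional \<Rightarrow> real" where
  "norm_minus S F = (SUP u \<in> {u \<in> Hplus S. norm_plus S u \<le> 1}. cmod (F u))"

definition embed :: "'a::complex_hilbert graph \<Rightarrow> 'a \<Rightarrow> 'a functional" where
  "embed S h = (\<lambda>u. if u \<in> Hplus S then cinner h u else 0)"

text \<open>Bounded operators from the positive to the negative space, from the complex numbers
  to the negative space, and from the positive space to the complex numbers.
  In the first and third case only the values on the positive space are relevant.\<close>

definition ops_plus_minus :: "'a::complex_hilbert graph \<Rightarrow> ('a \<Rightarrow> 'a functional) set" where
  "ops_plus_minus S = {B. (\<forall>f \<in> Hplus S. B f \<in> Hminus S) \<and>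
    (\<forall>f \<in> Hplus S. \<forall>g \<in> Hplus S. B (f + g) = (\<lambda>u. B f u + B g u)) \<and>
    (\<forall>c. \<forall>f \<in> Hplus S. B (c *\<^sub>C f) = (\<lambda>u. c * B f u)) \<and>
    (\<exists>C. \<forall>f \<in> Hplus S. norm_minus S (B f) \<le> C * norm_plus S f)}"

definition ops_C_minus :: "'a::complex_hilbert graph \<Rightarrow> (complex \<Rightarrow> 'a functional) set" where
  "ops_C_minus S = {K. (\<forall>c. K c \<in> Hminus S) \<and>
    (\<forall>c d. K (c + d) = (\<lambda>u. K c u + K d u)) \<and>
    (\<forall>c d. K (c * d) = (\<lambda>u. c * K d u)) \<and>
    (\<exists>C. \<forall>c. norm_minus S (K c) \<le> C * cmod c)}"

definition ops_plus_C :: "'a::complex_hilbert graph \<Rightarrow> ('a \<Rightarrow> complex) set" where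
  "ops_plus_C S = {M. (\<forall>f \<in> Hplus S. \<forall>g \<in> Hplus S. M (f + g) = M f + M g) \<and>
    (\<forall>c. \<forall>f \<in> Hplus S. M (c *\<^sub>C f) = c * M f) \<and>
    (\<exists>C. \<forall>f \<in> Hplus S. cmod (M f) \<le> C * norm_plus S f)}"

text \<open>The adjoints are determined by \<open>(B f, g) = (f, B* g)\<close> and \<open>(K c, u) = c * cnj (K* u)\<close>;
  see the two lemmas that follow.\<close>

definition adjoint_pm ::
    "'a::complex_hilbert graph \<Rightarrow> ('a \<Rightarrow> 'a functional) \<Rightarrow> 'a \<Rightarrow> 'a functional" where
  "adjoint_pm S B g = (\<lambda>f. if f \<in> Hplus S then cnj (B f g) else 0)"

definition adjoint_K :: "(complex \<Rightarrow> 'a functional) \<Rightarrow> 'a \<Rightarrow> complex" where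
  "adjoint_K K u = cnj (K 1 u)"

lemma adjoint_pm_eq: "f \<in> Hplus S \<Longrightarrow> B f g = cnj (adjoint_pm S B g f)"
  by (simp add: adjoint_pm_def)

lemma adjoint_K_eq:
  assumes "K \<in> ops_C_minus S"
  shows "K c u = c * cnj (adjoint_K K u)"
proof -
  have "K (c * 1) = (\<lambda>u. c * K 1 u)"
    using assms unfolding ops_C_minus_def by blast
  then show ?thesis by (simp add: adjoint_K_def)
qed

definition Re_pm ::
    "'a::complex_hilbert graph \<Rightarrow> ('a \<Rightarrow> 'a functional) \<Rightarrow> 'a \<Rightarrow> 'a functional" where
  "Re_pm S B f = (\<lambda>u. (B f u + adjoint_pm S B f u) / 2)"

definition Im_pm ::
    "'a::complex_hilbert graph \<Rightarrow> ('a \<Rightarrow> 'a functional) \<Rightarrow> 'a \<Rightarrow> 'a functional" where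
  "Im_pm S B f = (\<lambda>u. (B f u - adjoint_pm S B f u) / (2 * \<i>))"

definition extends_to ::
    "'a::complex_hilbert graph \<Rightarrow> 'a graph \<Rightarrow> ('a \<Rightarrow> 'a functional) \<Rightarrow> bool" where
  "extends_to S T B \<longleftrightarrow> (\<forall>(f, h) \<in> T. f \<in> Hplus S \<and> B f = embed S h)"

definition quasi_kernel ::
    "'a::complex_hilbert graph \<Rightarrow> ('a \<Rightarrow> 'a functional) \<Rightarrow> 'a graph" where
  "quasi_kernel S B = {(f, h). f \<in> Hplus S \<and> B f = embed S h}"


section \<open>L-systems\<close>

definition t_self_adjoint_biext ::
    "'a::complex_hilbert graph \<Rightarrow> ('a \<Rightarrow> 'a functional) \<Rightarrow> bool" where
  "t_self_adjoint_biext S B \<longleftrightarrow> B \<in> ops_plus_minus S \<and>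
    (\<forall>f \<in> Hplus S. adjoint_pm S B f = B f) \<and> extends_to S S B \<and>
    self_adjoint (quasi_kernel S B)"

definition class_Lambda :: "'a::complex_hilbert graph \<Rightarrow> 'a graph set" where
  "class_Lambda S = {T. linear_op T \<and> S \<subseteq> T \<and> T \<subseteq> adjoint_op S \<and> resolvent_set T \<noteq> {} \<and>
    Domain S = Domain T \<inter> Domain (adjoint_op T)}"

definition star_extension ::
    "'a::complex_hilbert graph \<Rightarrow> 'a graph \<Rightarrow> ('a \<Rightarrow> 'a functional) \<Rightarrow> bool" where
  "star_extension S T B \<longleftrightarrow> B \<in> ops_plus_minus S \<and>
    S \<subseteq> T \<and> extends_to S T B \<and>
    S \<subseteq> adjoint_op T \<and> extends_to S (adjoint_op T) (adjoint_pm S B) \<and>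
    t_self_adjoint_biext S (Re_pm S B)"

definition L_system ::
    "'a::complex_hilbert graph \<Rightarrow> ('a \<Rightarrow> 'a functional) \<Rightarrow> (complex \<Rightarrow> 'a functional) \<Rightarrow> bool" where
  "L_system S B K \<longleftrightarrow> (\<exists>T \<in> class_Lambda S. star_extension S T B) \<and>
    K \<in> ops_C_minus S \<and> adjoint_K K \<in> ops_plus_C S \<and>
    (\<forall>f \<in> Hplus S. Im_pm S B f = K (adjoint_K K f)) \<and>
    range K = Im_pm S B ` Hplus S"

definition main_operator ::
    "'a::complex_hilbert graph \<Rightarrow> ('a \<Rightarrow> 'a functional) \<Rightarrow> 'a graph" where
  "main_operator S B = {(f, h). f \<in> Hplus S \<and> B f = embed S h}"

text \<open>The impedance function acts on the complex numbers as multiplication by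
  its value at 1.\<close>

definition impedance ::
    "'a::complex_hilbert graph \<Rightarrow> ('a \<Rightarrow> 'a functional) \<Rightarrow> (complex \<Rightarrow> 'a functional) \<Rightarrow>
      complex \<Rightarrow> complex" where
  "impedance S B K z =
    adjoint_K K (the_inv_into (Hplus S) (\<lambda>f u. Re_pm S B f u - z * embed S f u) (K 1))"


section \<open>The generalized Donoghue class\<close>

definition upper_half_plane :: "complex set" where
  "upper_half_plane = {z. 0 < Im z}"

definition donoghue_class :: "real \<Rightarrow> (complex \<Rightarrow> complex) set" where
  "donoghue_class \<kappa> = {V. V holomorphic_on upper_half_plane \<and>
    V ` upper_half_plane \<subseteq> upper_half_plane \<and>
    (\<exists>\<mu> :: real measure. sets \<mu> = sets borel \<and> emeasure \<mu> UNIV = \<infinity> \<and>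
      (\<integral>\<^sup>+ x. ennreal (1 / (1 + x\<^sup>2)) \<partial>\<mu>) = ennreal ((1 - \<kappa>) / (1 + \<kappa>)) \<and>
      (\<forall>z \<in> upper_half_plane.
        V z = (\<integral>x. 1 / (complex_of_real x - z) - complex_of_real (x / (1 + x\<^sup>2)) \<partial>\<mu>)))}"

end

theory Submission
  imports Defs "HOL-Probability.Probability" "HOL-Complex_Analysis.Complex_Analysis"
begin

text \<open>
  Choose \<open>g\<^sub>+, g\<^sub>-\<close> with \<open>g\<^sub>+ - g\<^sub>-\<close> in the domain of the quasi-kernel \<open>A\<close>, and let \<open>c\<close> be the
  number with \<open>g\<^sub>+ - c g\<^sub>- \<in> Dom T\<close>. Hypothesis (H) with parameter \<open>\<kappa>\<close> says that \<open>c = \<kappa>\<close>.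
  As \<open>Re \<A>\<close> is hermitian with quasi-kernel \<open>A\<close>, it differs from the adjoint of \<open>S\<close> by a
  rank one form \<open>\<phi> \<otimes> \<eta>\<close> that is determined by the real number \<open>\<rho> = (Re \<A> g\<^sub>+, g\<^sub>+)\<close>. The domain of
  \<open>T\<close> forces \<open>K 1 = \<tau> \<eta>\<close>, and with \<open>s = \<bar>\<tau>\<bar>\<^sup>2\<close> one has
  \<open>1 - c = s (1 + c - \<i> \<rho> (1 - c))\<close> and \<open>V(z) = s (\<rho> + M(z))\<close>,
  where \<open>M\<close> is the Weyl function of \<open>A\<close> and \<open>g\<^sub>+\<close>, normalised by \<open>M(\<i>) = \<i>\<close>.
  If \<open>V\<close> is in the Donoghue class, its value at \<open>\<i>\<close> gives \<open>\<rho> = 0\<close> and \<open>s = (1 - \<kappa>) / (1 + \<kappa>)\<close>, hence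
  \<open>c = \<kappa>\<close>. Conversely, \<open>c = \<kappa>\<close> gives the same values of \<open>\<rho>\<close> and \<open>s\<close>, so \<open>V = s M\<close>, and \<open>M\<close> is the
  impedance function of the system obtained by rescaling \<open>Im \<A>\<close> by \<open>1 / s\<close>.

  The integral representation of \<open>M\<close> comes from the Herglotz theorem on the unit disc: the Schwarz
  formula on circles of radius \<open>r < 1\<close> yields probability measures, which have a weak limit
  for \<open>r \<rightarrow> 1\<close>, and the Cayley transform moves that limit to the real line.\<close>

section \<open>Complex Hilbert spaces\<close>

interpretation complex_vector: vector_space "scaleC :: complex \<Rightarrow> 'a \<Rightarrow> 'a::complex_hilbert"
  by (rule vector_space_scaleC)

context
  notes [simp] = cinner_add_left cinner_scaleC_left
begin

lemma cinner_zero_left [simp]: "cinner 0 y = 0"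
  using cinner_scaleC_left[of 0 0 y] by simp

lemma cinner_zero_right [simp]: "cinner x 0 = 0"
  by (subst cinner_commute) simp

lemma cinner_add_right: "cinner x (y + z) = cinner x y + cinner x z"
  by (subst (1 2 3) cinner_commute) simp

lemma cinner_scaleC_right: "cinner x (c *\<^sub>C y) = cnj c * cinner x y"
  by (subst (1 2) cinner_commute) simp

lemma cinner_minus_left: "cinner (- x) y = - cinner x y"
  using cinner_scaleC_left[of "-1" x y] by simp

lemma cinner_minus_right: "cinner x (- y) = - cinner x y"
  by (subst (1 2) cinner_commute) (simp add: cinner_minus_left)

lemma cinner_diff_left: "cinner (x - y) z = cinner x z - cinner y z"
  using cinner_add_left[of x "- y" z] by (simp add: cinner_minus_left)

lemma cinner_diff_right: "cinner x (y - z) = cinner x y - cinner x z"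
  using cinner_add_right[of x y "- z"] by (simp add: cinner_minus_right)

end

lemmas cinner_simps = cinner_add_left cinner_add_right cinner_diff_left cinner_diff_right
  cinner_minus_left cinner_minus_right cinner_scaleC_left cinner_scaleC_right

lemma cinner_eq_zero_iff [simp]: "cinner x x = 0 \<longleftrightarrow> x = (0::'a::complex_hilbert)"
  by (simp add: cinner_self)

lemma Re_cinner_commute: "Re (cinner y x) = Re (cinner x y)"
  by (subst cinner_commute) simp

lemma norm_scaleC: "norm (c *\<^sub>C x) = cmod c * norm (x::'a::complex_hilbert)"
proof -
  have "complex_of_real ((norm (c *\<^sub>C x))\<^sup>2) = c * cnj c * complex_of_real ((norm x)\<^sup>2)"
    by (metis cinner_self cinner_scaleC_left cinner_scaleC_right mult.assoc)
  also have "\<dots> = complex_of_real ((cmod c * norm x)\<^sup>2)"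
    by (simp add: complex_norm_square power_mult_distrib flip: of_real_power)
  finally have "(norm (c *\<^sub>C x))\<^sup>2 = (cmod c * norm x)\<^sup>2"
    using of_real_eq_iff by blast
  then show ?thesis by simp
qed

lemma norm_add_sq:
  "(norm (x + y))\<^sup>2 = (norm x)\<^sup>2 + (norm (y::'a::complex_hilbert))\<^sup>2 + 2 * Re (cinner x y)"
proof -
  have "complex_of_real ((norm (x + y))\<^sup>2) = cinner x x + cinner y y + (cinner x y + cnj (cinner x y))"
    unfolding cinner_self[symmetric] cinner_simps by (simp add: cinner_commute[of y x])
  also have "\<dots> = complex_of_real ((norm x)\<^sup>2 + (norm y)\<^sup>2 + 2 * Re (cinner x y))"
    by (simp add: complex_add_cnj cinner_self)
  finally show ?thesis using of_real_eq_iff by blast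
qed

lemma norm_diff_sq:
  "(norm (x - y))\<^sup>2 = (norm x)\<^sup>2 + (norm (y::'a::complex_hilbert))\<^sup>2 - 2 * Re (cinner x y)"
  using norm_add_sq[of x "- y"] by (simp add: cinner_simps)

lemma parallelogram_law:
  "(norm (x + y))\<^sup>2 + (norm (x - y))\<^sup>2 = 2 * (norm x)\<^sup>2 + 2 * (norm (y::'a::complex_hilbert))\<^sup>2"
  by (simp add: norm_add_sq norm_diff_sq)

lemma Cauchy_Schwarz: "cmod (cinner x y) \<le> norm x * norm (y::'a::complex_hilbert)"
proof (cases "y = 0")
  case False
  define c where "c = cinner x y"
  define n where "n = (norm y)\<^sup>2"
  have n: "n > 0" using False by (simp add: n_def)
  have "cinner x ((c / of_real n) *\<^sub>C y) = of_real ((cmod c)\<^sup>2 / n)"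
    by (simp add: cinner_simps c_def complex_norm_square mult.commute flip: of_real_power)
  then have "Re (cinner x ((c / of_real n) *\<^sub>C y)) = (cmod c)\<^sup>2 / n" by simp
  moreover have "(norm ((c / of_real n) *\<^sub>C y))\<^sup>2 = (cmod c)\<^sup>2 / n"
    using n by (simp add: norm_scaleC norm_divide power_mult_distrib power_divide n_def[symmetric])
      (simp add: power2_eq_square)
  ultimately have "0 \<le> (norm x)\<^sup>2 - (cmod c)\<^sup>2 / n"
    using norm_diff_sq[of x "(c / of_real n) *\<^sub>C y"]
      zero_le_power2[of "norm (x - (c / of_real n) *\<^sub>C y)"] by linarith
  then have "(cmod c)\<^sup>2 \<le> (norm x * norm y)\<^sup>2"
    using n by (simp add: field_simps n_def)
  then show ?thesis
    unfolding c_def by (rule power2_le_imp_le) simp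
qed simp

lemma bounded_linear_cinner_left: "bounded_linear (\<lambda>x::'a::complex_hilbert. cinner x y)"
  by (rule bounded_linear_intro[where K = "norm y"])
    (simp_all add: cinner_simps scaleR_scaleC scaleR_conv_of_real Cauchy_Schwarz)

lemma bounded_linear_cinner_right: "bounded_linear (\<lambda>y::'a::complex_hilbert. cinner x y)"
  by (rule bounded_linear_intro[where K = "norm x"])
    (simp_all add: cinner_simps scaleR_scaleC scaleR_conv_of_real Cauchy_Schwarz mult.commute[of _ "norm x"])

lemmas tendsto_cinner_left = bounded_linear.tendsto[OF bounded_linear_cinner_left]
lemmas tendsto_cinner_right = bounded_linear.tendsto[OF bounded_linear_cinner_right]

lemma bounded_linear_scaleC_right: "bounded_linear (\<lambda>x::'a::complex_hilbert. c *\<^sub>C x)"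
  by (rule bounded_linear_intro[where K = "cmod c"])
    (simp_all add: scaleC_add_right scaleR_scaleC scaleC_scaleC norm_scaleC mult.commute)

lemmas tendsto_scaleC_right = bounded_linear.tendsto[OF bounded_linear_scaleC_right]

lemma ortho_dense_imp_zero:
  fixes h :: "'a::complex_hilbert"
  assumes "closure D = UNIV" and "\<And>u. u \<in> D \<Longrightarrow> cinner h u = 0"
  shows "h = 0"
proof -
  have "h \<in> closure D" using assms(1) by simp
  then obtain u where u: "\<And>n. u n \<in> D" "u \<longlonglongrightarrow> h"
    unfolding closure_sequential by blast
  have "(\<lambda>n. cinner h (u n)) \<longlonglongrightarrow> cinner h h"
    by (rule tendsto_cinner_right[OF u(2)])
  moreover have "(\<lambda>n. cinner h (u n)) = (\<lambda>n. 0)" using u(1) assms(2) by auto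
  ultimately have "cinner h h = 0" by (simp add: LIMSEQ_const_iff)
  then show ?thesis by simp
qed

lemma cinner_eq_on_dense:
  fixes h k :: "'a::complex_hilbert"
  assumes "closure D = UNIV" and "\<And>u. u \<in> D \<Longrightarrow> cinner h u = cinner k u"
  shows "h = k"
  using ortho_dense_imp_zero[OF assms(1), of "h - k"] assms(2) by (simp add: cinner_simps)

theorem projection:
  fixes L :: "'a::complex_hilbert set"
  assumes L: "complex_vector.subspace L" and "closed L"
  obtains p where "p \<in> L" and "\<And>l. l \<in> L \<Longrightarrow> cinner (x - p) l = 0"
proof -
  define d where "d = infdist x L"
  have ne: "L \<noteq> {}" using complex_vector.subspace_0[OF L] by auto
  have d_le: "d \<le> norm (x - l)" if "l \<in> L" for l
    using infdist_le[OF that, of x] by (simp add: d_def dist_norm)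
  have "\<exists>l \<in> L. norm (x - l) < d + 1 / Suc n" for n
    using cINF_less_iff[OF ne bdd_below_image_dist, of x "d + 1 / Suc n"] ne
    by (auto simp: d_def infdist_notempty dist_norm)
  then obtain l where l: "\<And>n. l n \<in> L" "\<And>n. norm (x - l n) < d + 1 / Suc n"
    by metis
  have d0: "0 \<le> d" by (simp add: d_def infdist_nonneg)
  have lim: "(\<lambda>n. norm (x - l n)) \<longlonglongrightarrow> d"
  proof (rule tendsto_sandwich)
    show "(\<lambda>n. d) \<longlonglongrightarrow> d" "(\<lambda>n. d + 1 / Suc n) \<longlonglongrightarrow> d"
      using LIMSEQ_inverse_real_of_nat_add[of d] by (simp_all add: inverse_eq_divide del: of_nat_Suc)
  qed (use d_le l in \<open>auto simp: less_imp_le simp del: of_nat_Suc\<close>)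
  have mid: "(norm (l m - l n))\<^sup>2 \<le> 2 * (norm (x - l m))\<^sup>2 + 2 * (norm (x - l n))\<^sup>2 - 4 * d\<^sup>2" for m n
  proof -
    have "(1/2) *\<^sub>C (l m + l n) \<in> L"
      using l(1) L by (intro complex_vector.subspace_scale complex_vector.subspace_add)
    then have "d \<le> norm (x - (1/2) *\<^sub>C (l m + l n))" by (rule d_le)
    moreover have "(x - l m) + (x - l n) = 2 *\<^sub>C (x - (1/2) *\<^sub>C (l m + l n))"
      by (simp add: complex_vector.scale_right_diff_distrib scaleC_add_right)
        (metis (no_types, lifting) add_diff_eq diff_add_eq diff_diff_eq one_add_one scaleC_add_left scaleC_one)
    ultimately have "2 * d \<le> norm ((x - l m) + (x - l n))" by (simp add: norm_scaleC)
    then have "(2 * d)\<^sup>2 \<le> (norm ((x - l m) + (x - l n)))\<^sup>2"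
      using d0 by (intro power_mono) auto
    moreover have "norm ((x - l m) - (x - l n)) = norm (l m - l n)"
      by (simp add: norm_minus_commute)
    ultimately show ?thesis
      using parallelogram_law[of "x - l m" "x - l n"] by simp
  qed
  have "Cauchy l"
  proof (rule metric_CauchyI)
    fix e :: real assume e: "0 < e"
    have "(\<lambda>n. (norm (x - l n))\<^sup>2) \<longlonglongrightarrow> d\<^sup>2" by (intro tendsto_intros lim)
    then have "\<forall>\<^sub>F n in sequentially. (norm (x - l n))\<^sup>2 < d\<^sup>2 + e\<^sup>2 / 4"
      by (rule order_tendstoD) (use e in simp)
    then obtain N where N: "\<And>n. n \<ge> N \<Longrightarrow> (norm (x - l n))\<^sup>2 < d\<^sup>2 + e\<^sup>2 / 4"
      unfolding eventually_sequentially by blast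
    have "dist (l m) (l n) < e" if "m \<ge> N" "n \<ge> N" for m n
    proof -
      have "(norm (l m - l n))\<^sup>2 < e\<^sup>2" using mid[of m n] N[OF that(1)] N[OF that(2)] by argo
      then show ?thesis using e by (simp add: dist_norm power2_less_imp_less)
    qed
    then show "\<exists>N. \<forall>m\<ge>N. \<forall>n\<ge>N. dist (l m) (l n) < e" by blast
  qed
  then obtain p where p: "l \<longlonglongrightarrow> p" using convergent_eq_Cauchy by blast
  have pL: "p \<in> L" using closed_sequentially[OF \<open>closed L\<close>] l(1) p by blast
  have "(\<lambda>n. norm (x - l n)) \<longlonglongrightarrow> norm (x - p)" by (intro tendsto_intros p)
  then have np: "norm (x - p) = d" using lim LIMSEQ_unique by blast
  have "cinner (x - p) u = 0" if u: "u \<in> L" for u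
  proof (rule ccontr)
    assume nz: "cinner (x - p) u \<noteq> 0"
    define c where "c = cinner (x - p) u"
    define n where "n = (norm u)\<^sup>2"
    have n: "n > 0" using nz by (auto simp: n_def)
    have "p + (c / of_real n) *\<^sub>C u \<in> L"
      using L pL u by (intro complex_vector.subspace_scale complex_vector.subspace_add)
    from d_le[OF this] have "d\<^sup>2 \<le> (norm ((x - p) - (c / of_real n) *\<^sub>C u))\<^sup>2"
      using d0 by (intro power_mono) (auto simp: algebra_simps)
    moreover have "cinner (x - p) ((c / of_real n) *\<^sub>C u) = of_real ((cmod c)\<^sup>2 / n)"
      by (simp add: cinner_simps c_def complex_norm_square mult.commute flip: of_real_power)
    then have "Re (cinner (x - p) ((c / of_real n) *\<^sub>C u)) = (cmod c)\<^sup>2 / n" by simp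
    moreover have "(norm ((c / of_real n) *\<^sub>C u))\<^sup>2 = (cmod c)\<^sup>2 / n"
      using n by (simp add: norm_scaleC norm_divide power_mult_distrib power_divide n_def[symmetric])
        (simp add: power2_eq_square)
    ultimately have "d\<^sup>2 \<le> d\<^sup>2 + (cmod c)\<^sup>2 / n - 2 * ((cmod c)\<^sup>2 / n)"
      using norm_diff_sq[of "x - p" "(c / of_real n) *\<^sub>C u", unfolded np] by linarith
    then have "(cmod c)\<^sup>2 / n \<le> 0" by linarith
    then show False using n nz by (simp add: c_def divide_le_0_iff)
  qed
  with pL show ?thesis using that by blast
qed

section \<open>Operators\<close>

lemma linear_opD:
  assumes "linear_op R"
  shows "single_valued R" and "(0, 0) \<in> R"
    and "(f, h) \<in> R \<Longrightarrow> (g, k) \<in> R \<Longrightarrow> (f + g, h + k) \<in> R"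
    and "(f, h) \<in> R \<Longrightarrow> (c *\<^sub>C f, c *\<^sub>C h) \<in> R"
    and "(f, h) \<in> R \<Longrightarrow> (g, k) \<in> R \<Longrightarrow> (f - g, h - k) \<in> R"
proof -
  show "single_valued R" "(0, 0) \<in> R"
    and add: "(f, h) \<in> R \<Longrightarrow> (g, k) \<in> R \<Longrightarrow> (f + g, h + k) \<in> R"
    and scale: "(f, h) \<in> R \<Longrightarrow> (c *\<^sub>C f, c *\<^sub>C h) \<in> R" for f h g k c
    using assms unfolding linear_op_def by blast+
  assume "(f, h) \<in> R" "(g, k) \<in> R"
  from add[OF this(1) scale[OF this(2), of "-1"]] show "(f - g, h - k) \<in> R"
    by simp
qed

lemma single_valued_eq: "linear_op R \<Longrightarrow> (f, h) \<in> R \<Longrightarrow> (f, k) \<in> R \<Longrightarrow> h = k"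
  using linear_opD(1) single_valuedD by metis

lemma op_apply_eq: "linear_op R \<Longrightarrow> (f, h) \<in> R \<Longrightarrow> op_apply R f = h"
  unfolding op_apply_def using single_valued_eq by blast

lemma adjoint_op_iff: "(g, k) \<in> adjoint_op R \<longleftrightarrow> (\<forall>(f, h) \<in> R. cinner h g = cinner f k)"
  by (simp add: adjoint_in_def)

lemma adjoint_opD: "(g, k) \<in> adjoint_op R \<Longrightarrow> (f, h) \<in> R \<Longrightarrow> cinner h g = cinner f k"
  unfolding adjoint_op_iff by blast

lemma adjoint_op_cnjD: "(g, k) \<in> adjoint_op R \<Longrightarrow> (f, h) \<in> R \<Longrightarrow> cinner k f = cinner g h"
  by (subst (1 2) cinner_commute) (simp add: adjoint_opD)

lemma adjoint_op_antimono: "R \<subseteq> R' \<Longrightarrow> adjoint_op R' \<subseteq> adjoint_op R"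
  by (auto simp: adjoint_in_def)

lemma linear_op_adjoint:
  assumes "densely_defined R"
  shows "linear_op (adjoint_op R)"
  unfolding linear_op_def
proof (intro conjI allI impI)
  show "single_valued (adjoint_op R)"
  proof (rule single_valuedI)
    fix g k k' assume "(g, k) \<in> adjoint_op R" "(g, k') \<in> adjoint_op R"
    then show "k = k'"
      using assms unfolding densely_defined_def
      by (intro cinner_eq_on_dense[of "Domain R"]) (auto simp: adjoint_op_cnjD)
  qed
qed (auto simp: adjoint_op_iff cinner_simps split: prod.splits)

lemma closed_adjoint: "closed (adjoint_op R)"
proof (unfold closed_sequential_limits, intro allI impI, elim conjE)
  fix p :: "nat \<Rightarrow> 'a \<times> 'a" and q
  assume p: "\<forall>n. p n \<in> adjoint_op R" and lim: "p \<longlonglongrightarrow> q"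
  have "cinner h (fst q) = cinner f (snd q)" if "(f, h) \<in> R" for f h
  proof -
    have "cinner h (fst (p n)) = cinner f (snd (p n))" for n
      using p that adjoint_opD[of "fst (p n)" "snd (p n)" R] by simp
    moreover have "(\<lambda>n. cinner h (fst (p n))) \<longlonglongrightarrow> cinner h (fst q)"
      and "(\<lambda>n. cinner f (snd (p n))) \<longlonglongrightarrow> cinner f (snd q)"
      by (intro tendsto_cinner_right tendsto_intros lim)+
    ultimately show ?thesis using LIMSEQ_unique by auto
  qed
  then show "q \<in> adjoint_op R"
    by (cases q) (auto simp: adjoint_op_iff)
qed

lemma closed_range:
  assumes R: "linear_op R" "closed R"
    and bound: "\<And>f h. (f, h) \<in> R \<Longrightarrow> c * norm f \<le> norm (h - z *\<^sub>C f)" and c: "c > 0"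
  shows "closed {h - z *\<^sub>C f | f h. (f, h) \<in> R}" (is "closed ?L")
proof (unfold closed_sequential_limits, intro allI impI, elim conjE)
  fix y q assume "\<forall>n. y n \<in> ?L" and lim: "y \<longlonglongrightarrow> q"
  then obtain f h where fh: "\<And>n::nat. (f n, h n) \<in> R" and y: "y = (\<lambda>n. h n - z *\<^sub>C f n)"
    by simp metis
  have "Cauchy f"
  proof (rule metric_CauchyI)
    fix e :: real assume "0 < e"
    then have "0 < c * e" using c by simp
    then obtain N where N: "\<And>m n. m \<ge> N \<Longrightarrow> n \<ge> N \<Longrightarrow> dist (y m) (y n) < c * e"
      using metric_CauchyD[OF LIMSEQ_imp_Cauchy[OF lim]] by meson
    have "dist (f m) (f n) < e" if "m \<ge> N" "n \<ge> N" for m n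
    proof -
      have "c * norm (f m - f n) \<le> norm (h m - h n - z *\<^sub>C (f m - f n))"
        by (rule bound linear_opD R fh)+
      also have "h m - h n - z *\<^sub>C (f m - f n) = y m - y n"
        by (simp add: y complex_vector.scale_right_diff_distrib)
      also have "norm \<dots> < c * e" using N[OF that] by (simp add: dist_norm)
      finally show ?thesis using c by (simp add: dist_norm)
    qed
    then show "\<exists>N. \<forall>m\<ge>N. \<forall>n\<ge>N. dist (f m) (f n) < e" by blast
  qed
  then obtain g where g: "f \<longlonglongrightarrow> g" using convergent_eq_Cauchy by blast
  have "(\<lambda>n. y n + z *\<^sub>C f n) \<longlonglongrightarrow> q + z *\<^sub>C g"
    by (intro tendsto_add lim tendsto_scaleC_right g)
  then have "(\<lambda>n. (f n, h n)) \<longlonglongrightarrow> (g, q + z *\<^sub>C g)"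
    using g by (intro tendsto_Pair) (simp_all add: y)
  then have "(g, q + z *\<^sub>C g) \<in> R"
    using closed_sequentially[OF R(2), of "\<lambda>n. (f n, h n)"] fh by blast
  moreover have "q = (q + z *\<^sub>C g) - z *\<^sub>C g" by simp
  ultimately show "q \<in> ?L" by blast
qed

lemma subspace_range:
  assumes R: "linear_op R"
  shows "complex_vector.subspace {h - z *\<^sub>C f | f h. (f, h) \<in> R}" (is "complex_vector.subspace ?L")
proof (rule complex_vector.subspaceI)
  have "0 = 0 - z *\<^sub>C 0" by simp
  then show "0 \<in> ?L" using linear_opD(2)[OF R] by blast
next
  fix x y assume "x \<in> ?L" "y \<in> ?L"
  then obtain f h g k where fh: "(f, h) \<in> R" "(g, k) \<in> R"
    and *: "x = h - z *\<^sub>C f" "y = k - z *\<^sub>C g" by blast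
  have "x + y = (h + k) - z *\<^sub>C (f + g)" by (simp add: * scaleC_add_right)
  then show "x + y \<in> ?L" using linear_opD(3)[OF R fh] by blast
next
  fix c x assume "x \<in> ?L"
  then obtain f h where fh: "(f, h) \<in> R" and *: "x = h - z *\<^sub>C f" by blast
  have "c *\<^sub>C x = c *\<^sub>C h - z *\<^sub>C (c *\<^sub>C f)"
    by (simp add: * complex_vector.scale_right_diff_distrib complex_vector.scale_left_commute)
  then show "c *\<^sub>C x \<in> ?L" using linear_opD(4)[OF R fh] by blast
qed

lemma range_decomposition:
  assumes R: "linear_op R" "closed R"
    and bound: "\<And>f h. (f, h) \<in> R \<Longrightarrow> c * norm f \<le> norm (h - z *\<^sub>C f)" and c: "c > 0"
  obtains f h g where "(f, h) \<in> R" and "(g, cnj z *\<^sub>C g) \<in> adjoint_op R"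
    and "y = h - z *\<^sub>C f + g"
proof -
  obtain p where p: "p \<in> {h - z *\<^sub>C f | f h. (f, h) \<in> R}"
    and ortho: "\<And>l. l \<in> {h - z *\<^sub>C f | f h. (f, h) \<in> R} \<Longrightarrow> cinner (y - p) l = 0"
    using projection[where x = y, OF subspace_range[OF R(1)] closed_range[OF R bound c]] by blast
  then obtain f h where fh: "(f, h) \<in> R" and p_eq: "p = h - z *\<^sub>C f" by blast
  have "(y - p, cnj z *\<^sub>C (y - p)) \<in> adjoint_op R"
    unfolding adjoint_op_iff
  proof safe
    fix u k assume "(u, k) \<in> R"
    then have "cinner (y - p) (k - z *\<^sub>C u) = 0" using ortho by blast
    then have "cinner (k - z *\<^sub>C u) (y - p) = 0" by (subst cinner_commute) simp
    then show "cinner k (y - p) = cinner u (cnj z *\<^sub>C (y - p))"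
      by (simp add: cinner_diff_left cinner_scaleC_left cinner_scaleC_right)
  qed
  then show ?thesis using that fh p_eq by (metis add.commute diff_add_cancel)
qed

lemma symmetric_real:
  assumes "R \<subseteq> adjoint_op R" "(f, h) \<in> R"
  shows "Im (cinner h f) = 0"
proof -
  have "cinner h f = cinner f h" using assms adjoint_opD by blast
  then show ?thesis by (metis cinner_commute complex_cnj_cancel_iff complex_is_Real_iff Reals_cnj_iff)
qed

lemma dissipative_lower_bound:
  assumes "0 \<le> Im (cinner h f) * sgn (- Im z)" and "Im z \<noteq> 0"
  shows "\<bar>Im z\<bar> * norm f \<le> norm (h - z *\<^sub>C f)"
proof (cases "f = 0")
  case False
  have "Im (cinner (h - z *\<^sub>C f) f) = Im (cinner h f) - Im z * (norm f)\<^sup>2"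
    by (simp add: cinner_simps cinner_self)
  then have "\<bar>Im z\<bar> * (norm f)\<^sup>2 \<le> \<bar>Im (cinner (h - z *\<^sub>C f) f)\<bar>"
    using assms by (cases "Im z > 0") (auto simp: sgn_if abs_if zero_le_mult_iff split: if_splits)
  also have "\<dots> \<le> norm (h - z *\<^sub>C f) * norm f"
    using abs_Im_le_cmod Cauchy_Schwarz order_trans by blast
  finally show ?thesis using False by (simp add: power2_eq_square)
qed simp

lemma symmetric_lower_bound:
  assumes "R \<subseteq> adjoint_op R" "(f, h) \<in> R" "Im z \<noteq> 0"
  shows "\<bar>Im z\<bar> * norm f \<le> norm (h - z *\<^sub>C f)"
  by (rule dissipative_lower_bound) (use assms symmetric_real[OF assms(1,2)] in auto)

lemma self_adjoint_iff:
  "self_adjoint A \<longleftrightarrow> linear_op A \<and> densely_defined A \<and> adjoint_op A = A"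
  unfolding self_adjoint_in_def densely_defined_def by auto

lemma self_adjoint_resolvent:
  assumes A: "self_adjoint A" and z: "Im z \<noteq> 0"
  shows "\<exists>!f. (f, y + z *\<^sub>C f) \<in> A"
proof -
  have lin: "linear_op A" and adj: "adjoint_op A = A" using A by (simp_all add: self_adjoint_iff)
  have bound: "\<bar>Im w\<bar> * norm f \<le> norm (h - w *\<^sub>C f)" if "(f, h) \<in> A" "Im w \<noteq> 0" for f h w
    using symmetric_lower_bound that adj by blast
  have closed: "closed A" using closed_adjoint[of A] adj by simp
  obtain f h g where fh: "(f, h) \<in> A" and g: "(g, cnj z *\<^sub>C g) \<in> adjoint_op A"
    and y: "y = h - z *\<^sub>C f + g"
    using range_decomposition[OF lin closed bound, of z] z by (metis zero_less_abs_iff)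
  have "\<bar>Im (cnj z)\<bar> * norm g \<le> norm (cnj z *\<^sub>C g - cnj z *\<^sub>C g)"
    using bound g adj z by (metis complex_cnj_cancel_iff cnj.simps(2) neg_equal_0_iff_equal)
  then have "g = 0" using z by (simp add: mult_le_0_iff)
  then have "(f, y + z *\<^sub>C f) \<in> A" using fh y by simp
  moreover have "f' = f" if "(f', y + z *\<^sub>C f') \<in> A" for f'
  proof -
    have "(f' - f, z *\<^sub>C (f' - f)) \<in> A"
      using linear_opD(5)[OF lin that \<open>(f, y + z *\<^sub>C f) \<in> A\<close>]
      by (simp add: complex_vector.scale_right_diff_distrib)
    from bound[OF this z] show ?thesis using z by (simp add: mult_le_0_iff)
  qed
  ultimately show ?thesis by blast
qed

section \<open>The Herglotz representation\<close>

definition circ :: "real \<Rightarrow> complex" where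
  "circ t = exp (2 * of_real pi * \<i> * of_real t)"

lemma norm_circ [simp]: "cmod (circ t) = 1"
  by (simp add: circ_def)

lemma circ_nonzero [simp]: "circ t \<noteq> 0"
  by (simp add: circ_def)

lemma cnj_circ: "cnj (circ t) = inverse (circ t)"
  using complex_norm_square[of "circ t"] by (simp add: field_simps)

lemma isCont_circ: "isCont circ t"
  unfolding circ_def by (intro continuous_intros)

lemma continuous_on_circ [continuous_intros]: "continuous_on A circ"
  using continuous_at_imp_continuous_on isCont_circ by blast

lemma circ_diff_nonzero: "cmod w < 1 \<Longrightarrow> circ t - w \<noteq> 0"
  by (metis eq_iff_diff_eq_0 less_irrefl norm_circ)

lemma circ_Cauchy_formula:
  assumes F: "F holomorphic_on cball 0 1" and w: "cmod w < 1"
  shows "((\<lambda>t. F (circ t) * (circ t / (circ t - w))) has_integral F w) {0..1}"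
proof -
  have path: "circlepath 0 1 t = circ t" for t by (simp add: circlepath circ_def)
  have deriv: "vector_derivative (circlepath 0 1) (at t) = 2 * pi * \<i> * circ t" for t
    by (simp add: vector_derivative_circlepath circ_def)
  have "((\<lambda>u. F u / (u - w)) has_contour_integral (2 * of_real pi * \<i> * F w)) (circlepath 0 1)"
    by (rule Cauchy_integral_circlepath_simple) (use F w in auto)
  then have "((\<lambda>t. F (circ t) / (circ t - w) * (2 * pi * \<i> * circ t)) has_integral
      (2 * of_real pi * \<i> * F w)) {0..1}"
    unfolding has_contour_integral path deriv .
  then have "((\<lambda>t. (F (circ t) / (circ t - w) * (2 * pi * \<i> * circ t)) * (1 / (2 * of_real pi * \<i>)))
      has_integral (2 * of_real pi * \<i> * F w) * (1 / (2 * of_real pi * \<i>))) {0..1}"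
    by (rule has_integral_mult_left)
  then show ?thesis by (simp add: mult_ac)
qed

definition herglotz_kernel :: "complex \<Rightarrow> real \<Rightarrow> complex" where
  "herglotz_kernel w t = (circ t + w) / (circ t - w)"

lemma isCont_herglotz_kernel: "cmod w < 1 \<Longrightarrow> isCont (herglotz_kernel w) t"
  unfolding herglotz_kernel_def
  by (intro continuous_intros isCont_circ circ_diff_nonzero)

lemma norm_herglotz_kernel_le:
  assumes "cmod w < 1"
  shows "cmod (herglotz_kernel w t) \<le> 2 / (1 - cmod w)"
proof -
  have "cmod (circ t + w) \<le> 2" using norm_triangle_ineq[of "circ t" w] assms by simp
  moreover have "1 - cmod w \<le> cmod (circ t - w)" using norm_triangle_ineq2[of "circ t" w] by simp
  ultimately show ?thesis
    unfolding herglotz_kernel_def norm_divide using assms by (intro frac_le) auto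
qed

lemma Schwarz_formula:
  assumes F: "F holomorphic_on cball 0 1" and real: "F 0 \<in> \<real>" and w: "cmod w < 1"
  shows "((\<lambda>t. complex_of_real (Re (F (circ t))) * herglotz_kernel w t) has_integral F w) {0..1}"
proof -
  have I1: "((\<lambda>t. F (circ t) * (circ t / (circ t - w))) has_integral F w) {0..1}"
    by (rule circ_Cauchy_formula[OF F w])
  have I2: "((\<lambda>t. F (circ t)) has_integral F 0) {0..1}"
    using circ_Cauchy_formula[OF F, of 0] by simp
  have nz: "1 - cnj w * u \<noteq> 0" if "cmod u \<le> 1" for u
  proof
    assume "1 - cnj w * u = 0"
    then have "cmod w * cmod u = 1" by (metis complex_mod_cnj eq_iff_diff_eq_0 norm_mult norm_one)
    moreover have "cmod w * cmod u \<le> cmod w" using that mult_left_le by fastforce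
    ultimately show False using w by linarith
  qed
  have "(\<lambda>u. F u * ((1 + cnj w * u) / (1 - cnj w * u))) holomorphic_on cball 0 1"
    using nz by (intro holomorphic_intros F) auto
  from circ_Cauchy_formula[OF this, of 0]
  have "((\<lambda>t. F (circ t) * ((1 + cnj w * circ t) / (1 - cnj w * circ t))) has_integral F 0) {0..1}"
    by simp
  then have "((\<lambda>t. cnj (F (circ t) * ((1 + cnj w * circ t) / (1 - cnj w * circ t)))) has_integral cnj (F 0)) {0..1}"
    by (rule has_integral_cnj[unfolded o_def, THEN iffD2])
  moreover have "cnj (F (circ t) * ((1 + cnj w * circ t) / (1 - cnj w * circ t)))
      = cnj (F (circ t)) * herglotz_kernel w t" for t
    unfolding herglotz_kernel_def using circ_diff_nonzero[OF w, of t]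
    by (simp add: cnj_circ field_simps)
  ultimately have I3: "((\<lambda>t. cnj (F (circ t)) * herglotz_kernel w t) has_integral F 0) {0..1}"
    using real by (simp add: Reals_cnj_iff)
  have "((\<lambda>t. (2 * (F (circ t) * (circ t / (circ t - w))) - F (circ t)
      + cnj (F (circ t)) * herglotz_kernel w t) / 2) has_integral (2 * F w - F 0 + F 0) / 2) {0..1}"
    by (intro has_integral_divide has_integral_add has_integral_diff has_integral_mult_right I1 I2 I3)
  moreover have "(2 * (F (circ t) * (circ t / (circ t - w))) - F (circ t)
      + cnj (F (circ t)) * herglotz_kernel w t) / 2 = complex_of_real (Re (F (circ t))) * herglotz_kernel w t" for t
  proof -
    have 1: "2 * (F (circ t) * (circ t / (circ t - w))) - F (circ t) = F (circ t) * herglotz_kernel w t"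
      unfolding herglotz_kernel_def using circ_diff_nonzero[OF w, of t] by (simp add: field_simps)
    have 2: "complex_of_real (Re (F (circ t))) = (F (circ t) + cnj (F (circ t))) / 2"
      by (simp add: complex_add_cnj)
    show ?thesis unfolding 1 2 by (simp add: distrib_right)
  qed
  ultimately show ?thesis by simp
qed

lemma herglotz_measure:
  assumes F: "F holomorphic_on cball 0 1" and F0: "F 0 = 1"
    and pos: "\<And>u. u \<in> cball 0 1 \<Longrightarrow> 0 \<le> Re (F u)"
  obtains \<nu> :: "real measure" where "real_distribution \<nu>" and "emeasure \<nu> {0..1} = 1"
    and "\<And>w. cmod w < 1 \<Longrightarrow> integral\<^sup>L \<nu> (herglotz_kernel w) = F w"
proof -
  define p where "p t = indicator {0..1} t * Re (F (circ t))" for t :: real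
  define \<nu> where "\<nu> = density lborel (\<lambda>t. ennreal (p t))"
  have cont: "continuous_on {0..1} (\<lambda>t. F (circ t))"
    by (rule continuous_on_compose2[OF holomorphic_on_imp_continuous_on[OF F]])
      (auto intro: continuous_on_circ)
  have set_int: "set_integrable lborel {0..1} f \<and> integral\<^sup>L lborel (\<lambda>t. indicator {0..1} t *\<^sub>R f t) = I"
    if "continuous_on {0..1::real} f" "(f has_integral I) {0..1}" for f :: "real \<Rightarrow> 'b::euclidean_space" and I
  proof -
    have si: "set_integrable lborel {0..1} f"
      unfolding set_integrable_def by (rule borel_integrable_compact) (use that in auto)
    then have "set_lebesgue_integral lborel {0..1} f = I"
      using that(2) by (simp add: set_borel_integral_eq_integral integral_unique)
    with si show ?thesis by (simp add: set_lebesgue_integral_def)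
  qed
  have p_nonneg: "0 \<le> p t" for t using pos by (simp add: p_def indicator_def)
  have contRe: "continuous_on {0..1} (\<lambda>t. Re (F (circ t)))" by (intro continuous_intros cont)
  have p_meas [measurable]: "p \<in> borel_measurable borel"
    using borel_measurable_continuous_on_indicator[OF _ contRe] by (simp add: p_def[abs_def])
  have "((\<lambda>t. Re (F (circ t))) has_integral 1) {0..1}"
    using has_integral_Re[OF circ_Cauchy_formula[OF F, of 0]] by (simp add: F0)
  from set_int[OF contRe this]
  have p_int: "integrable lborel p" "integral\<^sup>L lborel p = 1"
    by (simp_all add: p_def[abs_def] set_integrable_def)
  have sets [simp]: "sets \<nu> = sets borel" "space \<nu> = UNIV" by (simp_all add: \<nu>_def)
  have e1: "emeasure \<nu> UNIV = 1"
    using nn_integral_eq_integral[OF p_int(1)] p_nonneg p_int(2)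
    by (simp add: \<nu>_def emeasure_density)
  have e2: "emeasure \<nu> {0..1} = emeasure \<nu> UNIV"
  proof -
    have "(\<integral>\<^sup>+ t. ennreal (p t) * indicator {0..1} t \<partial>lborel)
        = (\<integral>\<^sup>+ t. ennreal (p t) * indicator UNIV t \<partial>lborel)"
      by (rule nn_integral_cong) (auto simp: p_def indicator_def)
    then show ?thesis unfolding \<nu>_def by (subst (1 2) emeasure_density) auto
  qed
  have "real_distribution \<nu>"
    by (rule real_distribution.intro)
      (use e1 in \<open>auto simp: real_distribution_axioms_def intro!: prob_spaceI\<close>)
  moreover have "integral\<^sup>L \<nu> (herglotz_kernel w) = F w" if w: "cmod w < 1" for w
  proof -
    have [measurable]: "herglotz_kernel w \<in> borel_measurable borel"
      using isCont_herglotz_kernel[OF w]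
      by (intro borel_measurable_continuous_onI continuous_at_imp_continuous_on) auto
    have "integral\<^sup>L \<nu> (herglotz_kernel w) = (\<integral>t. p t *\<^sub>R herglotz_kernel w t \<partial>lborel)"
      unfolding \<nu>_def by (rule integral_density) (use p_nonneg in auto)
    also have "\<dots> = (\<integral>t. indicator {0..1} t *\<^sub>R (complex_of_real (Re (F (circ t))) * herglotz_kernel w t) \<partial>lborel)"
      by (rule Bochner_Integration.integral_cong) (auto simp: p_def indicator_def scaleR_conv_of_real)
    also have "\<dots> = F w"
    proof (rule conjunct2[OF set_int[OF _ Schwarz_formula[OF F _ w]]])
      show "continuous_on {0..1} (\<lambda>t. complex_of_real (Re (F (circ t))) * herglotz_kernel w t)"
        using isCont_herglotz_kernel[OF w] by (intro continuous_intros cont continuous_at_imp_continuous_on) auto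
    qed (simp add: F0)
    finally show ?thesis .
  qed
  ultimately show ?thesis using that e1 e2 by metis
qed

theorem herglotz_representation:
  assumes F: "F holomorphic_on ball 0 1" and F0: "F 0 = 1"
    and pos: "\<And>u. u \<in> ball 0 1 \<Longrightarrow> 0 \<le> Re (F u)"
  obtains \<nu> :: "real measure" where "real_distribution \<nu>"
    and "\<And>w. cmod w < 1 \<Longrightarrow> integral\<^sup>L \<nu> (herglotz_kernel w) = F w"
proof -
  define r where "r n = real (Suc n) / real (Suc (Suc n))" for n
  have r: "0 \<le> r n" "r n < 1" for n by (simp_all add: r_def)
  have r_lim: "r \<longlonglongrightarrow> 1" unfolding r_def
    using LIMSEQ_Suc[OF LIMSEQ_n_over_Suc_n[where 'a = real]] by simp
  have scaled: "complex_of_real (r n) * u \<in> ball 0 1" if "u \<in> cball 0 1" for n u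
  proof -
    have "r n * cmod u \<le> r n" using r that mult_left_le by fastforce
    then show ?thesis using r[of n] by (simp add: norm_mult)
  qed
  have "\<exists>\<nu>. real_distribution \<nu> \<and> emeasure \<nu> {0..1} = 1 \<and>
    (\<forall>w. cmod w < 1 \<longrightarrow> integral\<^sup>L \<nu> (herglotz_kernel w) = F (of_real (r n) * w))" for n
  proof (rule herglotz_measure[of "\<lambda>u. F (of_real (r n) * u)"])
    show "(\<lambda>u. F (of_real (r n) * u)) holomorphic_on cball 0 1"
      by (rule holomorphic_on_compose_gen[OF _ F, unfolded o_def]) (use scaled in \<open>auto intro!: holomorphic_intros simp del: mem_ball\<close>)
  qed (use F0 pos scaled in auto)
  then obtain \<nu> where \<nu>: "\<And>n. real_distribution (\<nu> n)" "\<And>n. emeasure (\<nu> n) {0..1} = 1"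
    and rep: "\<And>n w. cmod w < 1 \<Longrightarrow> integral\<^sup>L (\<nu> n) (herglotz_kernel w) = F (of_real (r n) * w)"
    by metis
  have "tight \<nu>"
    unfolding tight_def
  proof (intro conjI allI impI)
    fix \<epsilon> :: real assume \<epsilon>: "0 < \<epsilon>"
    have "1 - \<epsilon> < measure (\<nu> n) {-1<..1}" for n
    proof -
      interpret real_distribution "\<nu> n" by fact
      have "measure (\<nu> n) {0..1} \<le> measure (\<nu> n) {-1<..1}"
        by (rule finite_measure_mono) auto
      moreover have "measure (\<nu> n) {0..1} = 1" using \<nu>(2) by (simp add: measure_def)
      ultimately show ?thesis using \<epsilon> by linarith
    qed
    then show "\<exists>a b. a < b \<and> (\<forall>n. 1 - \<epsilon> < measure (\<nu> n) {a<..b})"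
      by (intro exI[of _ "-1"] exI[of _ 1]) auto
  qed (rule \<nu>)
  from tight_imp_convergent_subsubsequence[OF this strict_mono_id] obtain s M
    where s: "strict_mono (s :: nat \<Rightarrow> nat)" and M: "real_distribution M"
      and conv: "weak_conv_m (\<nu> \<circ> id \<circ> s) M" by blast
  have "integral\<^sup>L M (herglotz_kernel w) = F w" if w: "cmod w < 1" for w
  proof -
    have "(\<lambda>n. integral\<^sup>L ((\<nu> \<circ> id \<circ> s) n) (herglotz_kernel w)) \<longlonglongrightarrow> integral\<^sup>L M (herglotz_kernel w)"
      by (rule weak_conv_imp_integral_bdd_continuous_conv[OF _ M conv
          isCont_herglotz_kernel[OF w] norm_herglotz_kernel_le[OF w]]) (simp add: \<nu>)
    moreover have "(\<lambda>n. F (of_real (r (s n)) * w)) \<longlonglongrightarrow> F w"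
    proof (rule continuous_on_tendsto_compose[OF holomorphic_on_imp_continuous_on[OF F]])
      have "(\<lambda>n. of_real (r (s n)) * w) \<longlonglongrightarrow> of_real 1 * w"
        by (intro tendsto_intros LIMSEQ_subseq_LIMSEQ[OF r_lim s, unfolded o_def])
      then show "(\<lambda>n. of_real (r (s n)) * w) \<longlonglongrightarrow> w" by simp
    qed (use w scaled in auto)
    ultimately show ?thesis using rep[OF w] LIMSEQ_unique by (simp add: o_def)
  qed
  with M show ?thesis using that by blast
qed

text \<open>The real number whose image under \<open>x \<mapsto> (x - \<i>) / (x + \<i>)\<close> is \<open>circ t\<close>;
  at \<open>circ t = 1\<close>, the image of infinity, it has the junk value 0.\<close>

definition cayley_point :: "real \<Rightarrow> real" where
  "cayley_point t = Re (\<i> * (1 + circ t) / (1 - circ t))"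

lemma measurable_circ [measurable]: "circ \<in> borel_measurable borel"
  by (intro borel_measurable_continuous_onI continuous_on_circ)

lemma measurable_cayley_point [measurable]: "cayley_point \<in> borel_measurable borel"
  unfolding cayley_point_def by measurable

lemma of_real_cayley_point:
  assumes "circ t \<noteq> 1"
  shows "complex_of_real (cayley_point t) = \<i> * (1 + circ t) / (1 - circ t)"
proof -
  have "cnj (\<i> * (1 + circ t) / (1 - circ t)) = \<i> * (1 + circ t) / (1 - circ t)"
    using assms by (simp add: cnj_circ field_simps)
  then have "\<i> * (1 + circ t) / (1 - circ t) \<in> \<real>"
    by (simp only: Reals_cnj_iff)
  then show ?thesis unfolding cayley_point_def by (rule of_real_Re)
qed

definition cayley :: "complex \<Rightarrow> complex" where
  "cayley z = (z - \<i>) / (z + \<i>)"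

lemma UHP_nonzero: "0 < Im z \<Longrightarrow> z + \<i> \<noteq> 0"
  by (auto simp: complex_eq_iff)

lemma norm_cayley_less:
  assumes "0 < Im z"
  shows "cmod (cayley z) < 1"
proof -
  have "(cmod (z - \<i>))\<^sup>2 < (cmod (z + \<i>))\<^sup>2"
    unfolding cmod_power2 using assms by (simp add: power2_eq_square algebra_simps)
  then have "cmod (z - \<i>) < cmod (z + \<i>)" by (rule power2_less_imp_less) simp
  then show ?thesis using UHP_nonzero[OF assms] by (simp add: cayley_def norm_divide)
qed

lemma cayley_inverse:
  assumes "0 < Im z"
  shows "\<i> * (1 + cayley z) / (1 - cayley z) = z"
proof -
  have "1 + cayley z = 2 * z / (z + \<i>)" "1 - cayley z = 2 * \<i> / (z + \<i>)"
    using UHP_nonzero[OF assms] by (simp_all add: cayley_def field_simps)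
  then show ?thesis using UHP_nonzero[OF assms] by simp
qed

lemma Im_cayley_inverse:
  assumes "cmod w < 1"
  shows "0 < Im (\<i> * (1 + w) / (1 - w))"
proof -
  have "w \<noteq> 1" using assms by auto
  have "Im (\<i> * (1 + w) / (1 - w)) = (1 - (cmod w)\<^sup>2) / (cmod (1 - w))\<^sup>2"
    unfolding Im_divide cmod_power2 by (simp add: power2_eq_square algebra_simps)
  also have "\<dots> > 0" using assms \<open>w \<noteq> 1\<close> by (simp add: power_less_one_iff)
  finally show ?thesis .
qed

lemma herglotz_kernel_cayley:
  fixes z :: complex
  assumes z: "0 < Im z"
  shows "\<i> * herglotz_kernel (cayley z) t =
    (if circ t = 1 then z else (1 + of_real (cayley_point t) * z) / (of_real (cayley_point t) - z))"
proof (cases "circ t = 1")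
  case True
  then show ?thesis using cayley_inverse[OF z] by (simp add: herglotz_kernel_def)
next
  case False
  define c where "c = circ t"
  have c: "1 - c \<noteq> 0" using False by (simp add: c_def)
  note nz = UHP_nonzero[OF z]
  have d: "c * (z + \<i>) - (z - \<i>) \<noteq> 0"
    using circ_diff_nonzero[OF norm_cayley_less[OF z], of t] nz
    by (auto simp: cayley_def c_def field_simps)
  have "c + cayley z = (c * (z + \<i>) + (z - \<i>)) / (z + \<i>)"
    "c - cayley z = (c * (z + \<i>) - (z - \<i>)) / (z + \<i>)"
    using nz by (simp_all add: cayley_def field_simps)
  then have "\<i> * herglotz_kernel (cayley z) t = \<i> * (c * (z + \<i>) + (z - \<i>)) / (c * (z + \<i>) - (z - \<i>))"
    using nz unfolding herglotz_kernel_def c_def[symmetric] by simp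
  moreover have "1 + of_real (cayley_point t) * z = \<i> * (c * (z + \<i>) + (z - \<i>)) / (1 - c)"
    "of_real (cayley_point t) - z = (c * (z + \<i>) - (z - \<i>)) / (1 - c)"
    using c unfolding of_real_cayley_point[OF False] c_def[symmetric] by (simp_all add: field_simps)
  ultimately show ?thesis using False c by simp
qed

lemma Im_nevanlinna_kernel:
  assumes "Im z \<noteq> 0"
  shows "Im ((1 + complex_of_real x * z) / (complex_of_real x - z)) = Im z * (1 + x\<^sup>2) / (cmod (complex_of_real x - z))\<^sup>2"
proof -
  have "(Re (complex_of_real x - z))\<^sup>2 + (Im (complex_of_real x - z))\<^sup>2 = (cmod (complex_of_real x - z))\<^sup>2"
    by (simp add: cmod_power2)
  then show ?thesis unfolding Im_divide
    by (simp add: power2_eq_square algebra_simps)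
qed

lemma nevanlinna_kernel_eq:
  assumes "Im z \<noteq> 0"
  shows "(1 + complex_of_real x * z) / (complex_of_real x - z)
    = (1 + x\<^sup>2) *\<^sub>R (1 / (complex_of_real x - z) - complex_of_real (x / (1 + x\<^sup>2)))"
proof -
  have "complex_of_real x - z \<noteq> 0" using assms by (auto simp: complex_eq_iff)
  moreover have "1 + x\<^sup>2 \<noteq> 0" by (metis add.commute not_sum_power2_lt_zero power_one sum_power2_eq_zero_iff zero_neq_one)
  then have "complex_of_real (1 + x\<^sup>2) \<noteq> 0" using of_real_eq_0_iff by blast
  moreover have "(1 + a * z) / (a - z) = b * (1 / (a - z) - a / b)"
    if "a - z \<noteq> 0" "b \<noteq> 0" "b = 1 + a\<^sup>2" for a b :: complex
  proof -
    have "1 + a * z = b - a * (a - z)" by (simp add: that power2_eq_square algebra_simps)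
    then have "(1 + a * z) / (a - z) = b / (a - z) - a * (a - z) / (a - z)"
      by (simp only: diff_divide_distrib)
    also have "\<dots> = b * (1 / (a - z) - a / b)" using that(1,2) by (simp add: right_diff_distrib[of b])
    finally show ?thesis .
  qed
  ultimately show ?thesis by (simp add: scaleR_conv_of_real)
qed

text \<open>The growth condition excludes an atom at infinity, that is, a linear term;
  unboundedness makes the measure infinite.\<close>

theorem donoghue_representation:
  assumes M: "M holomorphic_on upper_half_plane" and Mi: "M \<i> = \<i>"
    and pos: "\<And>z. z \<in> upper_half_plane \<Longrightarrow> 0 \<le> Im (M z)"
    and growth: "((\<lambda>y. Im (M (\<i> * of_real y)) / y) \<longlongrightarrow> 0) at_top"
    and unbounded: "\<And>B. \<exists>y > 0. B < y * Im (M (\<i> * of_real y))"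
    and s: "0 < s"
  obtains \<mu> :: "real measure" where "sets \<mu> = sets borel" and "emeasure \<mu> UNIV = \<infinity>"
    and "(\<integral>\<^sup>+ x. ennreal (1 / (1 + x\<^sup>2)) \<partial>\<mu>) = ennreal s"
    and "\<And>z. z \<in> upper_half_plane \<Longrightarrow>
        of_real s * M z = (\<integral>x. 1 / (complex_of_real x - z) - complex_of_real (x / (1 + x\<^sup>2)) \<partial>\<mu>)"
proof -
  define P where "P w = - \<i> * M (\<i> * (1 + w) / (1 - w))" for w
  have "P holomorphic_on ball 0 1"
    unfolding P_def
  proof (intro holomorphic_intros holomorphic_on_compose_gen[OF _ M, unfolded o_def])
    show "(\<lambda>w. \<i> * (1 + w) / (1 - w)) ` ball 0 1 \<subseteq> upper_half_plane"
      using Im_cayley_inverse by (auto simp: upper_half_plane_def)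
  qed auto
  moreover have "P 0 = 1" by (simp add: P_def Mi)
  moreover have "0 \<le> Re (P u)" if "u \<in> ball 0 1" for u
    using pos Im_cayley_inverse that by (simp add: P_def upper_half_plane_def)
  ultimately obtain \<nu> where \<nu>: "real_distribution \<nu>"
    and rep: "\<And>w. cmod w < 1 \<Longrightarrow> integral\<^sup>L \<nu> (herglotz_kernel w) = P w"
    using herglotz_representation by blast
  interpret real_distribution \<nu> by fact
  define k where "k z t = \<i> * herglotz_kernel (cayley z) t" for z t
  note k_eq = herglotz_kernel_cayley[folded k_def]
  have k_meas [measurable]: "k z \<in> borel_measurable borel" if "0 < Im z" for z
    unfolding k_def using isCont_herglotz_kernel[OF norm_cayley_less[OF that]]
    by (intro borel_measurable_continuous_onI continuous_intros continuous_at_imp_continuous_on) auto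
  have k_int: "integrable \<nu> (k z)" if "0 < Im z" for z
    using k_meas[OF that] norm_herglotz_kernel_le[OF norm_cayley_less[OF that]]
    by (intro integrable_const_bound[where B = "2 / (1 - cmod (cayley z))"]) (auto simp: k_def norm_mult)
  have M_eq: "M z = integral\<^sup>L \<nu> (k z)" if z: "0 < Im z" for z
  proof -
    have "integral\<^sup>L \<nu> (k z) = \<i> * P (cayley z)"
      unfolding k_def using rep[OF norm_cayley_less[OF z]] by simp
    then show ?thesis by (simp add: P_def cayley_inverse[OF z])
  qed
  have Im_M: "Im (M z) = (\<integral>t. Im (k z t) \<partial>\<nu>)" if z: "0 < Im z" for z
    using M_eq[OF z] k_int[OF z] by simp
  have Im_k: "Im (k z t) = (if circ t = 1 then Im z else
      Im z * (1 + (cayley_point t)\<^sup>2) / (cmod (complex_of_real (cayley_point t) - z))\<^sup>2)" if z: "0 < Im z" for z t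
    using Im_nevanlinna_kernel[of z "cayley_point t"] z by (simp add: k_eq[OF z])
  have [measurable]: "{t. circ t = 1} \<in> sets borel" by measurable
  have atom_le: "prob {t. circ t = 1} \<le> Im (M (\<i> * of_real y)) / y" if y: "0 < y" for y
  proof -
    have "Im (k (\<i> * of_real y) t) \<ge> y * indicator {t. circ t = 1} t" for t
      using y by (simp add: Im_k indicator_def)
    then have "(\<integral>t. y * indicator {t. circ t = 1} t \<partial>\<nu>) \<le> (\<integral>t. Im (k (\<i> * of_real y) t) \<partial>\<nu>)"
      using y by (intro integral_mono) (auto intro!: integrable_Im k_int integrable_real_indicator simp: less_top[symmetric])
    then have "y * prob {t. circ t = 1} \<le> Im (M (\<i> * of_real y))"
      using y by (simp add: Im_M)
    then show ?thesis using y by (simp add: field_simps)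
  qed
  have "prob {t. circ t = 1} \<le> 0"
    by (rule tendsto_lowerbound[OF growth]) (use atom_le in \<open>auto intro: eventually_mono[OF eventually_gt_at_top[of 0]]\<close>)
  then have "emeasure \<nu> {t. circ t = 1} = 0"
    by (simp add: emeasure_eq_measure measure_le_0_iff)
  then have ae: "AE t in \<nu>. circ t \<noteq> 1"
    by (intro AE_I[where N = "{t. circ t = 1}"]) auto
  define f where "f t = s * (1 + (cayley_point t)\<^sup>2)" for t
  have [measurable]: "f \<in> borel_measurable borel" unfolding f_def by measurable
  have f0: "0 \<le> f t" for t using s by (simp add: f_def)
  define \<mu> where "\<mu> = distr (density \<nu> (\<lambda>t. ennreal (f t))) borel cayley_point"
  show ?thesis
  proof (rule that)
    show "sets \<mu> = sets borel" by (simp add: \<mu>_def)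
    have "(\<integral>\<^sup>+ x. ennreal (1 / (1 + x\<^sup>2)) \<partial>\<mu>) = (\<integral>\<^sup>+ t. ennreal (f t) * ennreal (1 / (1 + (cayley_point t)\<^sup>2)) \<partial>\<nu>)"
      unfolding \<mu>_def by (subst nn_integral_distr) (auto simp: nn_integral_density)
    also have "\<dots> = (\<integral>\<^sup>+ t. ennreal s \<partial>\<nu>)"
    proof (rule nn_integral_cong)
      fix t
      have "0 < 1 + (cayley_point t)\<^sup>2" by (simp add: add_pos_nonneg)
      then have "f t * (1 / (1 + (cayley_point t)\<^sup>2)) = s" by (simp add: f_def)
      then show "ennreal (f t) * ennreal (1 / (1 + (cayley_point t)\<^sup>2)) = ennreal s"
        using f0[of t] by (simp flip: ennreal_mult')
    qed
    also have "\<dots> = ennreal s" using emeasure_space_1 by simp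
    finally show "(\<integral>\<^sup>+ x. ennreal (1 / (1 + x\<^sup>2)) \<partial>\<mu>) = ennreal s" .
    show "of_real s * M z = (\<integral>x. 1 / (complex_of_real x - z) - complex_of_real (x / (1 + x\<^sup>2)) \<partial>\<mu>)"
      if "z \<in> upper_half_plane" for z
    proof -
      have z: "0 < Im z" using that by (simp add: upper_half_plane_def)
      have "(\<integral>x. 1 / (complex_of_real x - z) - complex_of_real (x / (1 + x\<^sup>2)) \<partial>\<mu>)
        = (\<integral>t. f t *\<^sub>R (1 / (complex_of_real (cayley_point t) - z)
            - complex_of_real (cayley_point t / (1 + (cayley_point t)\<^sup>2))) \<partial>\<nu>)"
        unfolding \<mu>_def using f0 by (subst integral_distr) (auto simp: integral_density)
      also have "\<dots> = (\<integral>t. of_real s * k z t \<partial>\<nu>)"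
      proof (rule integral_cong_AE)
        show "AE t in \<nu>. f t *\<^sub>R (1 / (complex_of_real (cayley_point t) - z)
            - complex_of_real (cayley_point t / (1 + (cayley_point t)\<^sup>2))) = of_real s * k z t"
          using ae
        proof (rule AE_mp, intro AE_I2 impI)
          fix t assume "circ t \<noteq> 1"
          then show "f t *\<^sub>R (1 / (complex_of_real (cayley_point t) - z)
            - complex_of_real (cayley_point t / (1 + (cayley_point t)\<^sup>2))) = of_real s * k z t"
            using z nevanlinna_kernel_eq[of z "cayley_point t"]
            by (simp add: k_eq[OF z] f_def scaleR_conv_of_real mult.assoc)
        qed
      qed (use k_meas[OF z] in auto)
      also have "\<dots> = of_real s * M z" by (simp add: M_eq[OF z])
      finally show ?thesis by simp
    qed
    show "emeasure \<mu> UNIV = \<infinity>"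
    proof (rule ccontr)
      assume "emeasure \<mu> UNIV \<noteq> \<infinity>"
      moreover have "emeasure \<mu> UNIV = (\<integral>\<^sup>+ t. ennreal (f t) \<partial>\<nu>)"
        by (simp add: \<mu>_def emeasure_distr emeasure_density)
      ultimately have f_int: "integrable \<nu> f"
        using f0 by (intro integrableI_nonneg) (auto simp: top.not_eq_extremum)
      have "s * (y * Im (M (\<i> * of_real y))) \<le> integral\<^sup>L \<nu> f" if y: "0 < y" for y
      proof -
        have "s * (y * Im (M (\<i> * of_real y))) = (\<integral>t. s * (y * Im (k (\<i> * of_real y) t)) \<partial>\<nu>)"
          using y by (simp add: Im_M)
        also have "\<dots> \<le> integral\<^sup>L \<nu> f"
        proof (rule integral_mono_AE[OF _ f_int])
          show "integrable \<nu> (\<lambda>t. s * (y * Im (k (\<i> * of_real y) t)))"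
            using y by (auto intro!: integrable_Im k_int)
          show "AE t in \<nu>. s * (y * Im (k (\<i> * of_real y) t)) \<le> f t"
            using ae
          proof (rule AE_mp, intro AE_I2 impI)
            fix t assume t: "circ t \<noteq> 1"
            define x where "x = cayley_point t"
            have "(cmod (complex_of_real x - \<i> * of_real y))\<^sup>2 = x\<^sup>2 + y\<^sup>2"
              by (simp add: cmod_power2)
            then have "y * Im (k (\<i> * of_real y) t) = y\<^sup>2 * (1 + x\<^sup>2) / (x\<^sup>2 + y\<^sup>2)"
              using y t by (simp add: Im_k x_def power2_eq_square[of y])
            also have "\<dots> \<le> 1 + x\<^sup>2"
            proof -
              have "0 < x\<^sup>2 + y\<^sup>2" using y by (simp add: add_nonneg_pos)
              moreover have "y\<^sup>2 * (1 + x\<^sup>2) \<le> (x\<^sup>2 + y\<^sup>2) * (1 + x\<^sup>2)"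
                by (intro mult_right_mono) auto
              ultimately show ?thesis by (simp add: divide_le_eq mult.commute)
            qed
            finally show "s * (y * Im (k (\<i> * of_real y) t)) \<le> f t"
              using s by (simp add: f_def x_def)
          qed
        qed
        finally show ?thesis .
      qed
      moreover obtain y where "y > 0" "integral\<^sup>L \<nu> f / s < y * Im (M (\<i> * of_real y))"
        using unbounded by blast
      ultimately show False using s by (simp add: divide_less_eq mult.commute) (metis not_le)
    qed
  qed
qed

section \<open>The Weyl function of a self-adjoint operator\<close>

locale self_adjoint_operator =
  fixes A :: "'a::complex_hilbert graph"
  assumes self_adjoint: "self_adjoint A"
begin

lemma linear: "linear_op A" and adjoint_eq: "adjoint_op A = A" and dense: "closure (Domain A) = UNIV"
  using self_adjoint by (simp_all add: self_adjoint_iff densely_defined_def)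

definition resolvent :: "complex \<Rightarrow> 'a \<Rightarrow> 'a" where
  "resolvent z y = (THE f. (f, y + z *\<^sub>C f) \<in> A)"

lemma resolvent: "Im z \<noteq> 0 \<Longrightarrow> (resolvent z y, y + z *\<^sub>C resolvent z y) \<in> A"
  unfolding resolvent_def by (rule theI'[OF self_adjoint_resolvent[OF self_adjoint]])

lemma resolvent_eqI: "Im z \<noteq> 0 \<Longrightarrow> (f, y + z *\<^sub>C f) \<in> A \<Longrightarrow> resolvent z y = f"
  using self_adjoint_resolvent[OF self_adjoint] resolvent by blast

lemma lower_bound:
  "(f, h) \<in> A \<Longrightarrow> Im z \<noteq> 0 \<Longrightarrow> \<bar>Im z\<bar> * norm f \<le> norm (h - z *\<^sub>C f)"
  using symmetric_lower_bound adjoint_eq by blast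

lemma norm_resolvent_le: "Im z \<noteq> 0 \<Longrightarrow> norm (resolvent z y) \<le> norm y / \<bar>Im z\<bar>"
  using lower_bound[OF resolvent, of z z y] by (simp add: field_simps)

lemma resolvent_add:
  assumes "Im z \<noteq> 0"
  shows "resolvent z (x + y) = resolvent z x + resolvent z y"
proof (rule resolvent_eqI)
  show "(resolvent z x + resolvent z y, x + y + z *\<^sub>C (resolvent z x + resolvent z y)) \<in> A"
    using linear_opD(3)[OF linear resolvent[OF assms, of x] resolvent[OF assms, of y]]
    by (simp add: scaleC_add_right algebra_simps)
qed fact

lemma resolvent_scale:
  assumes "Im z \<noteq> 0"
  shows "resolvent z (c *\<^sub>C x) = c *\<^sub>C resolvent z x"
proof (rule resolvent_eqI)
  show "(c *\<^sub>C resolvent z x, c *\<^sub>C x + z *\<^sub>C c *\<^sub>C resolvent z x) \<in> A"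
    using linear_opD(4)[OF linear resolvent[OF assms, of x], of c]
    by (simp add: scaleC_add_right mult.commute[of z c])
qed fact

lemma resolvent_diff:
  assumes "Im z \<noteq> 0"
  shows "resolvent z (x - y) = resolvent z x - resolvent z y"
  using resolvent_add[OF assms, of "x - y" y] by simp

lemma resolvent_identity:
  assumes "Im z \<noteq> 0" and w: "Im w \<noteq> 0"
  shows "resolvent z y - resolvent w y = (z - w) *\<^sub>C resolvent z (resolvent w y)"
proof -
  have "resolvent z (y + (w - z) *\<^sub>C resolvent w y) = resolvent w y"
  proof (rule resolvent_eqI)
    have "y + (w - z) *\<^sub>C resolvent w y + z *\<^sub>C resolvent w y = y + w *\<^sub>C resolvent w y"
      by (simp add: complex_vector.scale_left_diff_distrib)
    then show "(resolvent w y, y + (w - z) *\<^sub>C resolvent w y + z *\<^sub>C resolvent w y) \<in> A"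
      using resolvent[OF w] by (simp only:)
  qed fact
  then have "resolvent z y + (w - z) *\<^sub>C resolvent z (resolvent w y) = resolvent w y"
    by (simp only: resolvent_add resolvent_scale assms(1) not_False_eq_True)
  then show ?thesis
    by (simp add: complex_vector.scale_left_diff_distrib algebra_simps)
qed

lemma tendsto_cinner_resolvent:
  assumes z: "0 < Im z"
  shows "((\<lambda>w. cinner (resolvent w v) g) \<longlongrightarrow> cinner (resolvent z v) g) (at z)"
proof -
  have ev: "\<forall>\<^sub>F w in at z. Im z / 2 < Im w"
    by (rule order_tendstoD[of Im "Im z"]) (use z in \<open>auto intro!: tendsto_intros\<close>)
  have "((\<lambda>w. cinner (resolvent w v) g - cinner (resolvent z v) g) \<longlongrightarrow> 0) (at z)"
  proof (rule Lim_null_comparison)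
    show "\<forall>\<^sub>F w in at z. norm (cinner (resolvent w v) g - cinner (resolvent z v) g)
        \<le> cmod (w - z) * (norm (resolvent z v) / (Im z / 2) * norm g)"
      using ev
    proof eventually_elim
      case (elim w)
      then have w: "0 < Im w" using z by simp
      have diff: "cinner (resolvent w v) g - cinner (resolvent z v) g
          = (w - z) * cinner (resolvent w (resolvent z v)) g"
        using resolvent_identity[of w z v] w z by (simp flip: cinner_diff_left cinner_scaleC_left)
      have le1: "cmod (cinner (resolvent w (resolvent z v)) g) \<le> norm (resolvent w (resolvent z v)) * norm g"
        by (rule Cauchy_Schwarz)
      have le2: "norm (resolvent w (resolvent z v)) * norm g \<le> norm (resolvent z v) / (Im z / 2) * norm g"
      proof (rule mult_right_mono)
        have "norm (resolvent z v) / Im w \<le> norm (resolvent z v) / (Im z / 2)"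
          using w elim z by (intro divide_left_mono) auto
        then show "norm (resolvent w (resolvent z v)) \<le> norm (resolvent z v) / (Im z / 2)"
          using norm_resolvent_le[of w "resolvent z v"] w by simp
      qed simp
      show ?case
        unfolding diff norm_mult by (rule mult_left_mono[OF order_trans[OF le1 le2]]) simp
    qed
    have "((\<lambda>w. cmod (w - z) * (norm (resolvent z v) / (Im z / 2) * norm g)) \<longlongrightarrow>
        cmod (z - z) * (norm (resolvent z v) / (Im z / 2) * norm g)) (at z)"
      using z by (intro tendsto_intros) auto
    then show "((\<lambda>w. cmod (w - z) * (norm (resolvent z v) / (Im z / 2) * norm g)) \<longlongrightarrow> 0) (at z)" by simp
  qed
  then show ?thesis by (simp add: LIM_zero_iff)
qed

lemma holomorphic_cinner_resolvent:
  "(\<lambda>z. cinner (resolvent z v) g) holomorphic_on upper_half_plane"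
proof -
  have "((\<lambda>z. cinner (resolvent z v) g) has_field_derivative cinner (resolvent z (resolvent z v)) g) (at z)"
    if "z \<in> upper_half_plane" for z
  proof -
    have z: "0 < Im z" using that by (simp add: upper_half_plane_def)
    have "\<forall>\<^sub>F w in at z. 0 < Im w"
      by (rule order_tendstoD[of Im "Im z"]) (use z in \<open>auto intro!: tendsto_intros\<close>)
    moreover have "\<forall>\<^sub>F w in at z. w \<noteq> z" by (simp add: eventually_at_filter)
    ultimately have "\<forall>\<^sub>F w in at z. cinner (resolvent w (resolvent z v)) g
        = (cinner (resolvent w v) g - cinner (resolvent z v) g) / (w - z)"
    proof eventually_elim
      case (elim w)
      have "cinner (resolvent w v) g - cinner (resolvent z v) g
          = (w - z) * cinner (resolvent w (resolvent z v)) g"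
        using resolvent_identity[of w z v] elim z by (simp flip: cinner_diff_left cinner_scaleC_left)
      then show ?case using elim by simp
    qed
    from Lim_transform_eventually[OF tendsto_cinner_resolvent[OF z] this]
    show ?thesis by (simp add: has_field_derivative_iff)
  qed
  then show ?thesis
    unfolding holomorphic_on_def field_differentiable_def
    using has_field_derivative_at_within by blast
qed

definition defect :: "'a \<Rightarrow> complex \<Rightarrow> 'a" where
  "defect g z = g + (z - \<i>) *\<^sub>C resolvent z g"

definition weyl :: "'a \<Rightarrow> complex \<Rightarrow> complex" where
  "weyl g z = (z + \<i>) * cinner (defect g z) g - \<i>"

lemma defect_ii [simp]: "defect g \<i> = g"
  by (simp add: defect_def)

lemma defect_diff:
  assumes "Im z \<noteq> 0"
  shows "(g - defect g z, \<i> *\<^sub>C g - z *\<^sub>C defect g z) \<in> A"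
proof -
  have "(\<i> - z) *\<^sub>C (g + z *\<^sub>C resolvent z g) = \<i> *\<^sub>C g - z *\<^sub>C defect g z"
    by (simp add: defect_def scaleC_add_right complex_vector.scale_left_diff_distrib
        scaleC_scaleC right_diff_distrib left_diff_distrib
        complex_vector.scale_right_diff_distrib)
  moreover have "(\<i> - z) *\<^sub>C resolvent z g = g - defect g z"
    by (simp add: defect_def complex_vector.scale_left_diff_distrib)
  ultimately show ?thesis
    using linear_opD(4)[OF linear resolvent[OF assms, of g], of "\<i> - z"] by simp
qed

lemma Im_weyl:
  assumes "norm g = 1" and z: "Im z \<noteq> 0"
  shows "Im (weyl g z) = Im z * (norm (defect g z))\<^sup>2"
proof -
  define f where "f = resolvent z g"
  define p where "p = cinner f g"
  define n where "n = (norm f)\<^sup>2"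
  have gg: "cinner g g = 1" using assms by (simp add: cinner_self)
  have "Im (cinner (g + z *\<^sub>C f) f) = 0"
    using resolvent[OF z, of g] symmetric_real[of A] adjoint_eq by (simp add: f_def)
  moreover have "cinner (g + z *\<^sub>C f) f = cnj p + z * of_real n"
    unfolding cinner_simps p_def n_def cinner_self by (simp flip: cinner_commute)
  ultimately have p: "Im p = Im z * n" by simp
  have 0: "cinner (defect g z) g = 1 + (z - \<i>) * p"
    unfolding defect_def cinner_simps f_def[symmetric] p_def[symmetric] gg by simp
  have 1: "weyl g z = z + (z\<^sup>2 + 1) * p"
    unfolding weyl_def 0 by (simp add: algebra_simps power2_eq_square)
  have "(norm (defect g z))\<^sup>2 = 1 + (cmod (z - \<i>))\<^sup>2 * n + 2 * Re (cinner g ((z - \<i>) *\<^sub>C f))"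
    unfolding defect_def norm_add_sq f_def[symmetric] norm_scaleC using assms
    by (simp add: power_mult_distrib n_def)
  also have "Re (cinner g ((z - \<i>) *\<^sub>C f)) = Re ((z - \<i>) * p)"
    by (simp add: p_def Re_cinner_commute[of g] flip: cinner_scaleC_left)
  finally have 2: "(norm (defect g z))\<^sup>2 = 1 + ((Re z)\<^sup>2 + (Im z - 1)\<^sup>2) * n + 2 * Re ((z - \<i>) * p)"
    by (simp add: cmod_power2)
  show ?thesis unfolding 1 2 by (simp add: p power2_eq_square algebra_simps)
qed

lemma weyl_ii:
  assumes "norm g = 1"
  shows "weyl g \<i> = \<i>"
  using assms by (simp add: weyl_def cinner_self)

lemma holomorphic_weyl: "weyl g holomorphic_on upper_half_plane"
proof -
  have "weyl g = (\<lambda>z. (z + \<i>) * (cinner g g + (z - \<i>) * cinner (resolvent z g) g) - \<i>)"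
    by (simp add: fun_eq_iff weyl_def defect_def cinner_simps)
  then show ?thesis by (auto intro!: holomorphic_intros holomorphic_cinner_resolvent)
qed

lemma norm_defect_le:
  assumes uk: "(u, k) \<in> A" and y: "1 \<le> y"
  shows "norm (defect g (\<i> * of_real y)) \<le> 2 * norm (g - u) + (norm k + norm u) / y"
proof -
  define z where "z = \<i> * of_real y"
  have z: "Im z = y" "Im z \<noteq> 0" using y by (simp_all add: z_def)
  have "resolvent z (k - z *\<^sub>C u) = u" by (rule resolvent_eqI[OF z(2)]) (simp add: uk)
  then have u: "z *\<^sub>C resolvent z u = resolvent z k - u"
    using z by (simp add: resolvent_diff resolvent_scale algebra_simps)
  have "defect g z = (g - u) + (z - \<i>) *\<^sub>C resolvent z (g - u) + (u + (z - \<i>) *\<^sub>C resolvent z u)"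
    using z by (simp add: defect_def resolvent_diff complex_vector.scale_right_diff_distrib)
  also have "u + (z - \<i>) *\<^sub>C resolvent z u = resolvent z k - \<i> *\<^sub>C resolvent z u"
    using u by (simp add: complex_vector.scale_left_diff_distrib)
  finally have "norm (defect g z) \<le> norm (g - u) + norm ((z - \<i>) *\<^sub>C resolvent z (g - u))
      + (norm (resolvent z k) + norm (\<i> *\<^sub>C resolvent z u))"
    by (metis add_mono norm_triangle_ineq norm_triangle_ineq4 norm_triangle_mono order_refl)
  moreover have "norm ((z - \<i>) *\<^sub>C resolvent z (g - u)) \<le> norm (g - u)"
  proof -
    have "cmod (z - \<i>) = y - 1"
      using y by (simp add: z_def cmod_def)
    then have "norm ((z - \<i>) *\<^sub>C resolvent z (g - u)) \<le> (y - 1) * (norm (g - u) / y)"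
      unfolding norm_scaleC using norm_resolvent_le[OF z(2), of "g - u"] y z
      by (simp only: abs_of_nonneg) (rule mult_left_mono; simp)
    also have "\<dots> \<le> y * (norm (g - u) / y)" using y by (intro mult_right_mono) auto
    finally show ?thesis using y by simp
  qed
  moreover have "norm (resolvent z k) \<le> norm k / y" "norm (\<i> *\<^sub>C resolvent z u) \<le> norm u / y"
    using norm_resolvent_le[OF z(2)] y z by (simp_all add: norm_scaleC)
  ultimately show ?thesis unfolding z_def[symmetric] add_divide_distrib by linarith
qed

lemma defect_tendsto_0: "((\<lambda>y. defect g (\<i> * of_real y)) \<longlongrightarrow> 0) at_top"
proof (rule tendstoI)
  fix e :: real assume e: "0 < e"
  obtain u k where uk: "(u, k) \<in> A" and u: "norm (g - u) < e / 4"
  proof -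
    have "g \<in> closure (Domain A)" using dense by simp
    then obtain u where "u \<in> Domain A" "dist u g < e / 4"
      using e unfolding closure_approachable by (metis zero_less_divide_iff zero_less_numeral)
    then show ?thesis using that by (auto simp: dist_norm norm_minus_commute)
  qed
  have "((\<lambda>y. (norm k + norm u) / y) \<longlongrightarrow> 0) at_top"
    by (rule real_tendsto_divide_at_top[OF tendsto_const filterlim_ident])
  then have "\<forall>\<^sub>F y in at_top. (norm k + norm u) / y < e / 2"
    by (rule order_tendstoD) (use e in simp)
  with eventually_ge_at_top[of 1] show "\<forall>\<^sub>F y in at_top. dist (defect g (\<i> * of_real y)) 0 < e"
  proof eventually_elim
    case (elim y)
    have "norm (defect g (\<i> * of_real y)) < e"
      using norm_defect_le[OF uk elim(1), of g] u elim(2) by argo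
    then show ?case by (simp add: dist_norm)
  qed
qed

lemma weyl_growth:
  assumes "norm g = 1"
  shows "((\<lambda>y. Im (weyl g (\<i> * of_real y)) / y) \<longlongrightarrow> 0) at_top"
proof -
  have "((\<lambda>y. (norm (defect g (\<i> * of_real y)))\<^sup>2) \<longlongrightarrow> 0) at_top"
    using tendsto_power[OF tendsto_norm[OF defect_tendsto_0], where n = 2] by simp
  then show ?thesis
    by (rule Lim_transform_eventually)
      (auto intro!: eventually_mono[OF eventually_gt_at_top[of 0]] simp: Im_weyl[OF assms])
qed

text \<open>If \<open>y\<^sup>2 \<parallel>g\<^sub>i\<^sub>y\<parallel>\<^sup>2\<close> were bounded, then \<open>y g\<^sub>i\<^sub>y\<close> would tend weakly to 0,
  and the boundary form of \<open>g\<close> with every element of the domain of \<open>A\<close> would vanish.\<close>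

lemma weyl_unbounded:
  assumes g: "norm g = 1" and S: "densely_defined S" "S \<subseteq> A" and adj: "(g, \<i> *\<^sub>C g) \<in> adjoint_op S"
  shows "\<exists>y > 0. B < y * Im (weyl g (\<i> * of_real y))"
proof (rule ccontr)
  assume "\<not> ?thesis"
  then have B: "y * Im (weyl g (\<i> * of_real y)) \<le> B" if "y > 0" for y
    using that by (meson not_less)
  define d where "d y = defect g (\<i> * of_real y)" for y
  define C where "C = sqrt \<bar>B\<bar>"
  have C: "norm (y *\<^sub>R d y) \<le> C" if "y > 0" for y
  proof -
    have "(norm (y *\<^sub>R d y))\<^sup>2 \<le> \<bar>B\<bar>"
      using B[OF that] that by (simp add: Im_weyl[OF g] d_def power_mult_distrib power2_eq_square mult_ac)
    then show ?thesis unfolding C_def by (rule real_le_rsqrt)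
  qed
  have d0: "(d \<longlongrightarrow> 0) at_top" unfolding d_def by (rule defect_tendsto_0)
  have key: "\<i> * cinner (y *\<^sub>R d y) e = \<i> * cinner g e - cinner g k + cinner (d y) k"
    if "(e, k) \<in> A" "y > 0" for e k y
  proof -
    have "cinner (\<i> *\<^sub>C g - (\<i> * of_real y) *\<^sub>C d y) e = cinner (g - d y) k"
      using adjoint_op_cnjD[of e k A] adjoint_opD[of e k A] defect_diff[of "\<i> * of_real y" g] that adjoint_eq
      unfolding d_def by simp
    then show ?thesis by (simp add: cinner_simps scaleR_scaleC algebra_simps)
  qed
  have weak0: "((\<lambda>y. cinner (y *\<^sub>R d y) e) \<longlongrightarrow> 0) at_top" if "(e, k) \<in> S" for e k
  proof -
    have "((\<lambda>y. - \<i> * cinner (d y) k) \<longlongrightarrow> - \<i> * cinner 0 k) at_top"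
      by (intro tendsto_intros tendsto_cinner_left d0)
    moreover have "\<forall>\<^sub>F y in at_top. - \<i> * cinner (d y) k = cinner (y *\<^sub>R d y) e"
    proof (rule eventually_mono[OF eventually_gt_at_top[of 0]])
      fix y :: real assume "0 < y"
      have "cinner (\<i> *\<^sub>C g) e = cinner g k" by (rule adjoint_op_cnjD[OF adj that])
      then have "\<i> * cinner (y *\<^sub>R d y) e = cinner (d y) k"
        using key[of e k y] that S(2) \<open>0 < y\<close> by (auto simp: cinner_simps)
      then have "- \<i> * (\<i> * cinner (y *\<^sub>R d y) e) = - \<i> * cinner (d y) k" by simp
      then show "- \<i> * cinner (d y) k = cinner (y *\<^sub>R d y) e" by (simp flip: mult.assoc)
    qed
    ultimately show ?thesis using Lim_transform_eventually by fastforce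
  qed
  have weak: "((\<lambda>y. cinner (y *\<^sub>R d y) e) \<longlongrightarrow> 0) at_top" for e
  proof (rule tendstoI)
    fix \<epsilon> :: real assume \<epsilon>: "0 < \<epsilon>"
    have "0 \<le> C" by (simp add: C_def)
    have half: "D * (r / (2 * D)) = r / 2" if "0 < D" for D r :: real using that by simp
    have "e \<in> closure (Domain S)" using S(1) by (simp add: densely_defined_def)
    moreover have "0 < \<epsilon> / (2 * (C + 1))" using \<epsilon> \<open>0 \<le> C\<close> by simp
    ultimately obtain e0 where "e0 \<in> Domain S" and e0: "dist e0 e < \<epsilon> / (2 * (C + 1))"
      unfolding closure_approachable by blast
    then obtain k0 where "(e0, k0) \<in> S" by blast
    from tendstoD[OF weak0[OF this], of "\<epsilon> / 2"] \<epsilon>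
    have "\<forall>\<^sub>F y in at_top. dist (cinner (y *\<^sub>R d y) e0) 0 < \<epsilon> / 2" by simp
    with eventually_gt_at_top[of 0] show "\<forall>\<^sub>F y in at_top. dist (cinner (y *\<^sub>R d y) e) 0 < \<epsilon>"
    proof eventually_elim
      case (elim y)
      have "cmod (cinner (y *\<^sub>R d y) (e - e0)) \<le> norm (y *\<^sub>R d y) * norm (e - e0)" by (rule Cauchy_Schwarz)
      also have "\<dots> \<le> (C + 1) * (\<epsilon> / (2 * (C + 1)))"
        using C[OF elim(1)] e0 \<open>0 \<le> C\<close> by (intro mult_mono) (auto simp: dist_norm norm_minus_commute)
      also have "\<dots> = \<epsilon> / 2" by (rule half) (use \<open>0 \<le> C\<close> in simp)
      finally have "cmod (cinner (y *\<^sub>R d y) (e - e0)) \<le> \<epsilon> / 2" .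
      moreover have "cinner (y *\<^sub>R d y) e = cinner (y *\<^sub>R d y) (e - e0) + cinner (y *\<^sub>R d y) e0"
        by (simp flip: cinner_add_right)
      ultimately show ?case
        using elim(2) norm_triangle_ineq[of "cinner (y *\<^sub>R d y) (e - e0)" "cinner (y *\<^sub>R d y) e0"] by simp
    qed
  qed
  have "(g, \<i> *\<^sub>C g) \<in> adjoint_op A"
    unfolding adjoint_op_iff
  proof safe
    fix e k assume ek: "(e, k) \<in> A"
    have "((\<lambda>y. \<i> * cinner (y *\<^sub>R d y) e - cinner (d y) k) \<longlongrightarrow> \<i> * 0 - cinner 0 k) at_top"
      by (intro tendsto_intros weak tendsto_cinner_left d0)
    moreover have "\<forall>\<^sub>F y in at_top. \<i> * cinner (y *\<^sub>R d y) e - cinner (d y) k = \<i> * cinner g e - cinner g k"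
      using key[OF ek] by (auto intro!: eventually_mono[OF eventually_gt_at_top[of 0]])
    ultimately have "((\<lambda>y::real. \<i> * cinner g e - cinner g k) \<longlongrightarrow> 0) at_top"
      using Lim_transform_eventually by fastforce
    then have "\<i> * cinner g e = cinner g k"
      by (simp add: tendsto_const_iff)
    then have "cnj (\<i> * cinner g e) = cnj (cinner g k)" by simp
    then show "cinner k g = cinner e (\<i> *\<^sub>C g)"
      by (simp add: cinner_simps flip: cinner_commute)
  qed
  then have "Im (cinner (\<i> *\<^sub>C g) g) = 0"
    using symmetric_real[of A] adjoint_eq by blast
  then show False using g by (simp add: cinner_simps cinner_self)
qed

theorem weyl_donoghue:
  assumes g: "norm g = 1" and S: "densely_defined S" "S \<subseteq> A" and adj: "(g, \<i> *\<^sub>C g) \<in> adjoint_op S"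
    and \<kappa>: "-1 < \<kappa>" "\<kappa> < 1"
    and V: "\<And>z. z \<in> upper_half_plane \<Longrightarrow> V z = of_real ((1 - \<kappa>) / (1 + \<kappa>)) * weyl g z"
  shows "V \<in> donoghue_class \<kappa>"
proof -
  define s where "s = (1 - \<kappa>) / (1 + \<kappa>)"
  have s: "0 < s" using \<kappa> by (simp add: s_def)
  have defect_nz: "defect g z \<noteq> 0" if z: "0 < Im z" for z
  proof
    assume "defect g z = 0"
    then have "(g, \<i> *\<^sub>C g) \<in> A" using defect_diff[of z g] z by simp
    then have "Im (cinner (\<i> *\<^sub>C g) g) = 0" using symmetric_real[of A] adjoint_eq by blast
    then show False using g by (simp add: cinner_simps cinner_self)
  qed
  have Im_pos: "0 < Im (weyl g z)" if "z \<in> upper_half_plane" for z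
    using that defect_nz[of z] by (simp add: upper_half_plane_def Im_weyl[OF g])
  show ?thesis
  proof (rule donoghue_representation[OF holomorphic_weyl weyl_ii[OF g] less_imp_le[OF Im_pos]
        weyl_growth[OF g] weyl_unbounded[OF g S adj] s])
    fix \<mu> :: "real measure" assume \<mu>: "sets \<mu> = sets borel" "emeasure \<mu> UNIV = \<infinity>"
      "(\<integral>\<^sup>+ x. ennreal (1 / (1 + x\<^sup>2)) \<partial>\<mu>) = ennreal s"
      "\<And>z. z \<in> upper_half_plane \<Longrightarrow>
          of_real s * weyl g z = (\<integral>x. 1 / (complex_of_real x - z) - complex_of_real (x / (1 + x\<^sup>2)) \<partial>\<mu>)"
    have "(\<lambda>z. of_real s * weyl g z) holomorphic_on upper_half_plane"
      by (intro holomorphic_intros holomorphic_weyl)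
    then have "V holomorphic_on upper_half_plane"
      by (rule holomorphic_transform) (simp add: V s_def)
    moreover have "V ` upper_half_plane \<subseteq> upper_half_plane"
    proof safe
      fix z assume "z \<in> upper_half_plane"
      then have "Im (V z) = s * Im (weyl g z)" "0 < Im (weyl g z)"
        using V Im_pos by (simp_all add: s_def)
      then show "V z \<in> upper_half_plane" using s by (simp add: upper_half_plane_def)
    qed
    ultimately show ?thesis
      unfolding donoghue_class_def s_def[symmetric]
      using \<mu> V[folded s_def] by (intro CollectI conjI exI[of _ \<mu>] ballI) (simp_all del: of_real_divide)
  qed
qed

end

lemma donoghue_class_ii:
  assumes V: "V \<in> donoghue_class \<kappa>" and \<kappa>: "\<kappa> < 1" "-1 < \<kappa>"
  shows "V \<i> = \<i> * of_real ((1 - \<kappa>) / (1 + \<kappa>))"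
proof -
  define s where "s = (1 - \<kappa>) / (1 + \<kappa>)"
  have s: "0 \<le> s" using \<kappa> by (simp add: s_def)
  obtain \<mu> :: "real measure" where sets: "sets \<mu> = sets borel"
    and nn: "(\<integral>\<^sup>+ x. ennreal (1 / (1 + x\<^sup>2)) \<partial>\<mu>) = ennreal s"
    and rep: "\<And>z. z \<in> upper_half_plane \<Longrightarrow>
        V z = (\<integral>x. 1 / (complex_of_real x - z) - complex_of_real (x / (1 + x\<^sup>2)) \<partial>\<mu>)"
    using V unfolding donoghue_class_def s_def by blast
  have [measurable]: "(\<lambda>x. 1 / (1 + x\<^sup>2)) \<in> borel_measurable \<mu>"
    using sets by measurable
  have int: "has_bochner_integral \<mu> (\<lambda>x. 1 / (1 + x\<^sup>2)) s"
    by (rule has_bochner_integral_nn_integral) (use nn s in auto)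
  have "1 / (complex_of_real x - \<i>) - complex_of_real (x / (1 + x\<^sup>2)) = \<i> * complex_of_real (1 / (1 + x\<^sup>2))"
    (is "?k = _") for x
  proof -
    have "complex_of_real x - \<i> \<noteq> 0" by (auto simp: complex_eq_iff)
    moreover have "1 + complex_of_real x * \<i> = \<i> * (complex_of_real x - \<i>)" by (simp add: algebra_simps)
    ultimately have "(1 + complex_of_real x * \<i>) / (complex_of_real x - \<i>) = \<i>"
      by simp
    then have "(1 + x\<^sup>2) *\<^sub>R ?k = \<i>"
      using nevanlinna_kernel_eq[of \<i> x] by (simp del: of_real_divide)
    moreover have "0 < 1 + x\<^sup>2" by (simp add: add_pos_nonneg)
    ultimately have "?k = (1 / (1 + x\<^sup>2)) *\<^sub>R \<i>"
      by (metis divide_self_if less_irrefl scaleR_one scaleR_scaleR times_divide_eq_left mult_1)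
    then show ?thesis by (simp only: scaleR_conv_of_real mult.commute)
  qed
  moreover have "\<i> \<in> upper_half_plane" by (simp add: upper_half_plane_def)
  ultimately have "V \<i> = (\<integral>x. \<i> * complex_of_real (1 / (1 + x\<^sup>2)) \<partial>\<mu>)"
    using rep by simp
  also have "\<dots> = \<i> * of_real s"
    using int unfolding has_bochner_integral_iff by (metis integral_complex_of_real integral_mult_right_zero)
  finally show ?thesis by (simp add: s_def)
qed

section \<open>Von Neumann's decomposition\<close>

lemma subspace_eigenspace:
  assumes "linear_op R"
  shows "complex_vector.subspace (eigenspace R z)"
proof (rule complex_vector.subspaceI)
  show "0 \<in> eigenspace R z" using linear_opD(2)[OF assms] by (simp add: eigenspace_def)
next
  fix x y assume "x \<in> eigenspace R z" "y \<in> eigenspace R z"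
  then show "x + y \<in> eigenspace R z"
    using linear_opD(3)[OF assms] by (auto simp: eigenspace_def scaleC_add_right)
next
  fix c x assume "x \<in> eigenspace R z"
  then have "(c *\<^sub>C x, c *\<^sub>C z *\<^sub>C x) \<in> R"
    using linear_opD(4)[OF assms] by (simp only: eigenspace_def mem_Collect_eq)
  then show "c *\<^sub>C x \<in> eigenspace R z"
    by (simp add: eigenspace_def mult.commute)
qed

lemma dim_1_multiple:
  fixes g x :: "'a::complex_hilbert"
  assumes V: "complex_vector.subspace V" "complex_vector.dim V = 1" and g: "g \<in> V" "g \<noteq> 0" and x: "x \<in> V"
  shows "\<exists>c. x = c *\<^sub>C g"
proof -
  obtain Bs where Bs: "Bs \<subseteq> V" "complex_vector.independent Bs" "V \<subseteq> complex_vector.span Bs" "card Bs = 1"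
    using complex_vector.basis_exists[of V] V(2) by metis
  then obtain b where b: "Bs = {b}" by (auto simp: card_1_singleton_iff)
  obtain k l where k: "x = k *\<^sub>C b" and l: "g = l *\<^sub>C b"
    using Bs(3) g(1) x unfolding b complex_vector.span_singleton by blast
  have "l \<noteq> 0" using g(2) l by auto
  then have "x = (k / l) *\<^sub>C g" by (simp add: k l)
  then show ?thesis by blast
qed

lemma deficiency_multiple:
  assumes S: "densely_defined S" and def: "deficiency_one_one S" and pair: "deficiency_pair S gp gm"
  shows "g \<in> eigenspace (adjoint_op S) \<i> \<Longrightarrow> \<exists>c. g = c *\<^sub>C gp"
    and "g \<in> eigenspace (adjoint_op S) (- \<i>) \<Longrightarrow> \<exists>c. g = c *\<^sub>C gm"
proof -
  have nz: "gp \<noteq> 0" "gm \<noteq> 0" using pair by (auto simp: deficiency_pair_def)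
  note sub = subspace_eigenspace[OF linear_op_adjoint[OF S]]
  show "g \<in> eigenspace (adjoint_op S) \<i> \<Longrightarrow> \<exists>c. g = c *\<^sub>C gp"
    by (rule dim_1_multiple[OF sub _ _ nz(1)])
      (use def pair in \<open>simp_all add: deficiency_one_one_def deficiency_pair_def\<close>)
  show "g \<in> eigenspace (adjoint_op S) (- \<i>) \<Longrightarrow> \<exists>c. g = c *\<^sub>C gm"
    by (rule dim_1_multiple[OF sub _ _ nz(2)])
      (use def pair in \<open>simp_all add: deficiency_one_one_def deficiency_pair_def\<close>)
qed

lemma von_neumann_decomposition:
  assumes S: "closed_symmetric S" and def: "deficiency_one_one S" and pair: "deficiency_pair S gp gm"
    and fh: "(f, h) \<in> adjoint_op S"
  obtains f0 h0 a b where "(f0, h0) \<in> S" and "f = f0 + a *\<^sub>C gp + b *\<^sub>C gm"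
    and "h = h0 + (\<i> * a) *\<^sub>C gp - (\<i> * b) *\<^sub>C gm"
proof -
  have lin: "linear_op S" "closed S" "S \<subseteq> adjoint_op S" and dense: "densely_defined S"
    using S by (simp_all add: closed_symmetric_def)
  note adj = linear_op_adjoint[OF dense]
  have bound: "1 * norm f \<le> norm (h - (- \<i>) *\<^sub>C f)" if "(f, h) \<in> S" for f h
    using symmetric_lower_bound[OF lin(3) that, of "- \<i>"] by simp
  obtain f0 h0 g where f0: "(f0, h0) \<in> S" and g: "(g, cnj (- \<i>) *\<^sub>C g) \<in> adjoint_op S"
    and eq: "h + \<i> *\<^sub>C f = h0 - (- \<i>) *\<^sub>C f0 + g"
    using range_decomposition[OF lin(1,2) bound, of "h + \<i> *\<^sub>C f"] by auto
  obtain c where c: "g = c *\<^sub>C gp"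
    using deficiency_multiple(1)[OF dense def pair, of g] g by (auto simp: eigenspace_def)
  define a where "a = c / (2 * \<i>)"
  have gp: "(gp, \<i> *\<^sub>C gp) \<in> adjoint_op S" using pair by (simp add: deficiency_pair_def eigenspace_def)
  define u where "u = f - f0 - a *\<^sub>C gp"
  define k where "k = h - h0 - a *\<^sub>C \<i> *\<^sub>C gp"
  have uk: "(u, k) \<in> adjoint_op S"
    unfolding u_def k_def using lin(3) f0
    by (intro linear_opD(4,5)[OF adj] fh gp) auto
  have "h = h0 + \<i> *\<^sub>C f0 + (2 * \<i> * a) *\<^sub>C gp - \<i> *\<^sub>C f"
    using eq by (simp add: a_def c algebra_simps)
  moreover have "(2 * \<i> * a) *\<^sub>C gp = (\<i> * a) *\<^sub>C gp + (\<i> * a) *\<^sub>C gp"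
    by (simp flip: scaleC_add_left)
  ultimately have "k = - \<i> *\<^sub>C u"
    by (simp add: k_def u_def scaleC_scaleC complex_vector.scale_right_diff_distrib mult.commute[of a \<i>]
        algebra_simps)
  then have "u \<in> eigenspace (adjoint_op S) (- \<i>)" using uk by (simp add: eigenspace_def)
  then obtain b where b: "u = b *\<^sub>C gm"
    using deficiency_multiple(2)[OF dense def pair] by blast
  show ?thesis
  proof (rule that[OF f0])
    show "f = f0 + a *\<^sub>C gp + b *\<^sub>C gm" using b by (simp add: u_def algebra_simps)
    have "h = k + h0 + (a * \<i>) *\<^sub>C gp" by (simp add: k_def)
    then show "h = h0 + (\<i> * a) *\<^sub>C gp - (\<i> * b) *\<^sub>C gm"
      by (simp add: \<open>k = - \<i> *\<^sub>C u\<close> b mult.commute[of a \<i>])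
  qed
qed

lemma cnj_cinner: "cnj (cinner x y) = cinner y x"
  by (simp flip: cinner_commute)

locale boundary_pair =
  fixes S A :: "'a::complex_hilbert graph" and gp gm :: 'a
  assumes S: "closed_symmetric S" and deficiency: "deficiency_one_one S"
    and pair: "deficiency_pair S gp gm"
    and A: "self_adjoint A" and S_A: "S \<subseteq> A" and e_A: "gp - gm \<in> Domain A"
begin

sublocale self_adjoint_operator A
  by unfold_locales (rule A)

lemma S_linear: "linear_op S" and S_symmetric: "S \<subseteq> adjoint_op S" and S_densely: "densely_defined S"
  using S by (simp_all add: closed_symmetric_def)

lemma S_dense: "closure (Domain S) = UNIV"
  using S_densely by (simp add: densely_defined_def)

lemma adj_linear: "linear_op (adjoint_op S)"
  by (rule linear_op_adjoint[OF S_densely])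

lemma A_adj: "A \<subseteq> adjoint_op S"
  using adjoint_op_antimono[OF S_A] adjoint_eq by simp

lemma gp: "(gp, \<i> *\<^sub>C gp) \<in> adjoint_op S" and gm: "(gm, - \<i> *\<^sub>C gm) \<in> adjoint_op S"
  and norm_gp [simp]: "norm gp = 1" and norm_gm [simp]: "norm gm = 1"
  using pair by (simp_all add: deficiency_pair_def eigenspace_def)

lemma cinner_gp [simp]: "cinner gp gp = 1" and cinner_gm [simp]: "cinner gm gm = 1"
  by (simp_all add: cinner_self)

lemma e: "(gp - gm, \<i> *\<^sub>C gp + \<i> *\<^sub>C gm) \<in> A"
proof -
  obtain k where k: "(gp - gm, k) \<in> A" using e_A by blast
  have "(gp - gm, \<i> *\<^sub>C gp - (- \<i> *\<^sub>C gm)) \<in> adjoint_op S"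
    by (rule linear_opD(5)[OF adj_linear gp gm])
  then have "k = \<i> *\<^sub>C gp - (- \<i> *\<^sub>C gm)"
    using single_valued_eq[OF adj_linear] k A_adj by blast
  with k show ?thesis by simp
qed

lemma Hplus_iff: "f \<in> Hplus S \<longleftrightarrow> (\<exists>h. (f, h) \<in> adjoint_op S)"
  unfolding Hplus_def by blast

lemma HplusI: "(f, h) \<in> adjoint_op S \<Longrightarrow> f \<in> Hplus S"
  unfolding Hplus_def by blast

lemma gp_Hplus: "gp \<in> Hplus S" and gm_Hplus: "gm \<in> Hplus S"
  using gp gm HplusI by blast+

lemma Hplus_add: "f \<in> Hplus S \<Longrightarrow> g \<in> Hplus S \<Longrightarrow> f + g \<in> Hplus S"
  unfolding Hplus_iff using linear_opD(3)[OF adj_linear] by blast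

lemma Hplus_scale: "f \<in> Hplus S \<Longrightarrow> c *\<^sub>C f \<in> Hplus S"
  unfolding Hplus_iff using linear_opD(4)[OF adj_linear] by blast

lemma Hplus_diff: "f \<in> Hplus S \<Longrightarrow> g \<in> Hplus S \<Longrightarrow> f - g \<in> Hplus S"
  unfolding Hplus_iff using linear_opD(5)[OF adj_linear] by blast

lemma S_Hplus: "(f, h) \<in> S \<Longrightarrow> f \<in> Hplus S" and A_Hplus: "(f, h) \<in> A \<Longrightarrow> f \<in> Hplus S"
  using S_symmetric A_adj HplusI by blast+

lemma zero_Hplus: "0 \<in> Hplus S"
  using linear_opD(2)[OF adj_linear] HplusI by blast

lemma decomposition:
  assumes "(f, h) \<in> adjoint_op S"
  obtains f0 h0 a b where "(f0, h0) \<in> S" and "f = f0 + a *\<^sub>C gp + b *\<^sub>C gm"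
    and "h = h0 + (\<i> * a) *\<^sub>C gp - (\<i> * b) *\<^sub>C gm"
  using von_neumann_decomposition[OF S deficiency pair assms] .

lemma defect_adj:
  assumes "Im z \<noteq> 0"
  shows "(defect gp z, z *\<^sub>C defect gp z) \<in> adjoint_op S"
proof -
  have "(gp - defect gp z, \<i> *\<^sub>C gp - z *\<^sub>C defect gp z) \<in> adjoint_op S"
    using defect_diff[OF assms] A_adj by blast
  from linear_opD(5)[OF adj_linear gp this] show ?thesis by simp
qed

subsection \<open>The dissipative extension with von Neumann parameter 0\<close>

definition T0 :: "'a graph" where
  "T0 = {(f + a *\<^sub>C gp, h + (\<i> * a) *\<^sub>C gp) | f h a. (f, h) \<in> S}"

lemma T0I: "(f, h) \<in> S \<Longrightarrow> (f + a *\<^sub>C gp, h + (\<i> * a) *\<^sub>C gp) \<in> T0"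
  unfolding T0_def by blast

lemma S_T0: "S \<subseteq> T0"
  using T0I[where a = 0] by auto

lemma gp_T0: "(gp, \<i> *\<^sub>C gp) \<in> T0"
  using T0I[OF linear_opD(2)[OF S_linear], of 1] by simp

lemma T0_adj: "T0 \<subseteq> adjoint_op S"
proof -
  have "(f + a *\<^sub>C gp, h + a *\<^sub>C \<i> *\<^sub>C gp) \<in> adjoint_op S" if "(f, h) \<in> S" for f h a
    using that S_symmetric by (intro linear_opD(3,4)[OF adj_linear] gp) auto
  then show ?thesis unfolding T0_def by (auto simp: scaleC_scaleC mult.commute)
qed

lemma T0_linear: "linear_op T0"
  unfolding linear_op_def
proof (intro conjI allI impI)
  show "single_valued T0"
    using T0_adj linear_opD(1)[OF adj_linear] single_valued_subset by blast
  show "(0, 0) \<in> T0" using S_T0 linear_opD(2)[OF S_linear] by blast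
next
  fix f h g k assume "(f, h) \<in> T0" "(g, k) \<in> T0"
  then obtain f0 h0 a g0 k0 b where *: "(f0, h0) \<in> S" "(g0, k0) \<in> S"
    "f = f0 + a *\<^sub>C gp" "h = h0 + (\<i> * a) *\<^sub>C gp" "g = g0 + b *\<^sub>C gp" "k = k0 + (\<i> * b) *\<^sub>C gp"
    unfolding T0_def by blast
  then have "f + g = (f0 + g0) + (a + b) *\<^sub>C gp" "h + k = (h0 + k0) + (\<i> * (a + b)) *\<^sub>C gp"
    by (simp_all add: scaleC_add_left distrib_left algebra_simps)
  then show "(f + g, h + k) \<in> T0" using T0I linear_opD(3)[OF S_linear *(1,2)] by simp
next
  fix c f h assume "(f, h) \<in> T0"
  then obtain f0 h0 a where *: "(f0, h0) \<in> S" "f = f0 + a *\<^sub>C gp" "h = h0 + (\<i> * a) *\<^sub>C gp"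
    unfolding T0_def by blast
  then have "c *\<^sub>C f = c *\<^sub>C f0 + (c * a) *\<^sub>C gp" "c *\<^sub>C h = c *\<^sub>C h0 + (\<i> * (c * a)) *\<^sub>C gp"
    by (simp_all add: scaleC_add_right scaleC_scaleC mult_ac)
  then show "(c *\<^sub>C f, c *\<^sub>C h) \<in> T0" using T0I linear_opD(4)[OF S_linear *(1)] by simp
qed

lemma T0_dissipative: "dissipative T0"
  unfolding dissipative_def
proof (intro conjI T0_linear, safe)
  fix f h assume "(f, h) \<in> T0"
  then obtain f0 h0 a where f0: "(f0, h0) \<in> S" and *: "f = f0 + a *\<^sub>C gp" "h = h0 + (\<i> * a) *\<^sub>C gp"
    unfolding T0_def by blast
  have "cinner h0 gp = cinner f0 (\<i> *\<^sub>C gp)" by (rule adjoint_opD[OF gp f0])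
  then have 1: "cinner h0 gp = - \<i> * cinner f0 gp" by (simp add: cinner_simps)
  have "cinner h f = cinner h0 f0 + cnj a * cinner h0 gp + \<i> * a * cnj (cinner f0 gp) + \<i> * (a * cnj a)"
    unfolding * by (simp add: cinner_simps cnj_cinner algebra_simps)
  then have "cinner h f = cinner h0 f0 + (cnj (\<i> * a * cnj (cinner f0 gp)) + \<i> * a * cnj (cinner f0 gp))
      + \<i> * of_real ((cmod a)\<^sup>2)"
    unfolding 1 complex_norm_square[symmetric] by (simp add: algebra_simps)
  then have "Im (cinner h f) = (cmod a)\<^sup>2"
    using symmetric_real[OF S_symmetric f0] by simp
  then show "0 \<le> Im (cinner h f)" by simp
qed

lemma dissipative_norm_le:
  assumes "dissipative T" "(f, h) \<in> T"
  shows "norm f \<le> norm (h - (- \<i>) *\<^sub>C f)"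
  using dissipative_lower_bound[of h f "- \<i>"] assms by (auto simp: dissipative_def)

lemma T0_surjective: "\<exists>f. (f, y + (- \<i>) *\<^sub>C f) \<in> T0"
proof -
  have bound: "1 * norm f \<le> norm (h - (- \<i>) *\<^sub>C f)" if "(f, h) \<in> S" for f h
    using symmetric_lower_bound[OF S_symmetric that, of "- \<i>"] by simp
  have "closed S" using S by (simp add: closed_symmetric_def)
  then obtain f0 h0 g where f0: "(f0, h0) \<in> S" and g: "(g, cnj (- \<i>) *\<^sub>C g) \<in> adjoint_op S"
    and eq: "y = h0 - (- \<i>) *\<^sub>C f0 + g"
    using range_decomposition[OF S_linear _ bound, of y] by auto
  obtain c where c: "g = c *\<^sub>C gp"
    using deficiency_multiple(1)[OF S_densely deficiency pair, of g] g by (auto simp: eigenspace_def)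
  define a where "a = c / (2 * \<i>)"
  have "g = (2 * \<i> * a) *\<^sub>C gp" by (simp add: a_def c)
  also have "\<dots> = (\<i> * a) *\<^sub>C gp + (\<i> * a) *\<^sub>C gp" by (simp flip: scaleC_add_left)
  finally have "h0 + (\<i> * a) *\<^sub>C gp = y + (- \<i>) *\<^sub>C (f0 + a *\<^sub>C gp)"
    by (simp add: eq scaleC_add_right scaleC_scaleC algebra_simps)
  then show ?thesis using T0I[OF f0, of a] by metis
qed

lemma dissipative_ext_unique:
  assumes T: "dissipative T" "(f, y + (- \<i>) *\<^sub>C f) \<in> T" "(f', y + (- \<i>) *\<^sub>C f') \<in> T"
  shows "f = f'"
proof -
  have "linear_op T" using T(1) by (simp add: dissipative_def)
  from linear_opD(5)[OF this T(2,3)] have "(f - f', (- \<i>) *\<^sub>C (f - f')) \<in> T"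
    by (simp add: complex_vector.scale_right_diff_distrib)
  from dissipative_norm_le[OF T(1) this] show ?thesis by simp
qed

lemma T0_max_dissipative: "max_dissipative_ext S T0"
  unfolding max_dissipative_ext_def
proof (intro conjI S_T0 T0_dissipative allI impI)
  fix T assume T: "dissipative T" "T0 \<subseteq> T"
  have "(f, h) \<in> T0" if fh: "(f, h) \<in> T" for f h
  proof -
    obtain f' where f': "(f', (h + \<i> *\<^sub>C f) + (- \<i>) *\<^sub>C f') \<in> T0" using T0_surjective by blast
    have "f = f'"
      by (rule dissipative_ext_unique[OF T(1), of _ "h + \<i> *\<^sub>C f"]) (use fh f' T(2) in auto)
    then show ?thesis using f' by simp
  qed
  with T(2) show "T = T0" by auto
qed

lemma T0_resolvent_set: "resolvent_set T0 \<noteq> {}"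
proof -
  have "- \<i> \<in> resolvent_set T0"
    unfolding resolvent_set_def
  proof (intro CollectI conjI allI exI[of _ 1])
    show "\<exists>!f. (f, h + (- \<i>) *\<^sub>C f) \<in> T0" for h
      using T0_surjective[of h] dissipative_ext_unique[OF T0_dissipative] by blast
    show "\<forall>(f, h)\<in>T0. norm f \<le> 1 * norm (h - (- \<i>) *\<^sub>C f)"
      using dissipative_norm_le[OF T0_dissipative] by auto
  qed
  then show ?thesis by blast
qed

lemma T0_not_self_adjoint: "T0 \<noteq> adjoint_op T0"
proof
  assume "T0 = adjoint_op T0"
  then have "Im (cinner (\<i> *\<^sub>C gp) gp) = 0"
    using symmetric_real[of T0] gp_T0 by blast
  then show False by (simp add: cinner_simps)
qed

lemma S_adj_T0: "S \<subseteq> adjoint_op T0"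
proof -
  have "cinner h f = cinner g k" if "(f, k) \<in> S" "(g, h) \<in> T0" for f k g h
    using adjoint_op_cnjD[of g h S f k] T0_adj that by blast
  then show ?thesis by (auto simp: adjoint_op_iff)
qed

lemma adj_T0_adj: "adjoint_op T0 \<subseteq> adjoint_op S"
  by (rule adjoint_op_antimono[OF S_T0])

lemma adj_T0_coordinate:
  assumes "(f, h) \<in> adjoint_op T0" "(f0, h0) \<in> S"
    and f: "f = f0 + a *\<^sub>C gp + b *\<^sub>C gm" "h = h0 + (\<i> * a) *\<^sub>C gp - (\<i> * b) *\<^sub>C gm"
  shows "a = 0"
proof -
  have "cinner (\<i> *\<^sub>C gp) f = cinner gp h"
    by (rule adjoint_opD[OF assms(1) gp_T0])
  moreover have "cinner (\<i> *\<^sub>C gp) f0 = cinner gp h0"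
    using adjoint_op_cnjD[OF gp assms(2)] .
  ultimately have "\<i> * cnj a = - \<i> * cnj a"
    unfolding f by (simp add: cinner_simps)
  then have "2 * \<i> * cnj a = 0" by (metis add.commute eq_neg_iff_add_eq_0 mult_2 mult.assoc mult_minus_left)
  then show ?thesis by simp
qed

lemma T0_Lambda: "T0 \<in> class_Lambda S"
  unfolding class_Lambda_def
proof (intro CollectI conjI T0_linear S_T0 T0_adj T0_resolvent_set equalityI subsetI)
  fix f assume "f \<in> Domain S"
  then show "f \<in> Domain T0 \<inter> Domain (adjoint_op T0)" using S_T0 S_adj_T0 by blast
next
  fix f assume "f \<in> Domain T0 \<inter> Domain (adjoint_op T0)"
  then obtain h k where h: "(f, h) \<in> T0" and k: "(f, k) \<in> adjoint_op T0" by blast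
  have "k = h" using single_valued_eq[OF adj_linear] h k T0_adj adj_T0_adj by blast
  obtain f0 h0 a where f0: "(f0, h0) \<in> S" and *: "f = f0 + a *\<^sub>C gp" "h = h0 + (\<i> * a) *\<^sub>C gp"
    using h unfolding T0_def by blast
  have "a = 0" using adj_T0_coordinate[OF k f0, of a 0] * \<open>k = h\<close> by simp
  then show "f \<in> Domain S" using f0 * by auto
qed

lemma T0_hypothesis_H: "hypothesis_H S T0 A 0"
  unfolding hypothesis_H_def
  using T0_not_self_adjoint T0_max_dissipative S_A A pair e_A gp_T0 by auto

end

section \<open>L-systems\<close>

lemma HminusD:
  assumes "F \<in> Hminus S"
  shows "u \<in> Hplus S \<Longrightarrow> v \<in> Hplus S \<Longrightarrow> F (u + v) = F u + F v"
    and "u \<in> Hplus S \<Longrightarrow> F (c *\<^sub>C u) = cnj c * F u"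
    and "u \<notin> Hplus S \<Longrightarrow> F u = 0"
  using assms by (auto simp: Hminus_def)

lemma Hminus_bounded:
  assumes "F \<in> Hminus S"
  shows "\<exists>C. \<forall>u \<in> Hplus S. cmod (F u) \<le> C * norm_plus S u"
  using assms by (simp add: Hminus_def)

lemma Hminus_combination:
  assumes F: "F \<in> Hminus S" and G: "G \<in> Hminus S"
  shows "(\<lambda>u. F u + d * G u) \<in> Hminus S"
proof -
  obtain C D where C: "\<And>u. u \<in> Hplus S \<Longrightarrow> cmod (F u) \<le> C * norm_plus S u"
    and D: "\<And>u. u \<in> Hplus S \<Longrightarrow> cmod (G u) \<le> D * norm_plus S u"
    using Hminus_bounded[OF F] Hminus_bounded[OF G] by blast
  have "cmod (F u + d * G u) \<le> (C + cmod d * D) * norm_plus S u" if "u \<in> Hplus S" for u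
  proof -
    have "cmod (F u + d * G u) \<le> cmod (F u) + cmod d * cmod (G u)"
      using norm_triangle_ineq[of "F u" "d * G u"] by (simp add: norm_mult)
    also have "\<dots> \<le> C * norm_plus S u + cmod d * (D * norm_plus S u)"
      using C[OF that] D[OF that] by (intro add_mono mult_left_mono) auto
    finally show ?thesis by (simp add: algebra_simps)
  qed
  then show ?thesis
    unfolding Hminus_def
    by (intro CollectI conjI ballI allI impI exI[of _ "C + cmod d * D"])
      (simp_all add: HminusD[OF F] HminusD[OF G] algebra_simps)
qed

lemma norm_plus_nonneg: "0 \<le> norm_plus S u"
  unfolding norm_plus_def cinner_plus_def by (simp add: cinner_self)

lemma norm_minus_upper:
  assumes F: "F \<in> Hminus S" and u: "u \<in> Hplus S" "norm_plus S u \<le> 1"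
  shows "cmod (F u) \<le> norm_minus S F"
proof -
  obtain C where C: "\<And>u. u \<in> Hplus S \<Longrightarrow> cmod (F u) \<le> C * norm_plus S u"
    using Hminus_bounded[OF F] by blast
  have "cmod (F v) \<le> \<bar>C\<bar>" if "v \<in> Hplus S" "norm_plus S v \<le> 1" for v
  proof -
    have "C * norm_plus S v \<le> \<bar>C\<bar> * norm_plus S v"
      using norm_plus_nonneg by (intro mult_right_mono) auto
    also have "\<dots> \<le> \<bar>C\<bar> * 1" using that by (intro mult_left_mono) auto
    finally show ?thesis using C[OF that(1)] by simp
  qed
  then have "bdd_above ((\<lambda>u. cmod (F u)) ` {u \<in> Hplus S. norm_plus S u \<le> 1})"
    by (auto intro!: bdd_aboveI[where M = "\<bar>C\<bar>"])
  then show ?thesis unfolding norm_minus_def by (rule cSUP_upper[rotated]) (use u in simp)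
qed

lemma norm_minus_combination:
  assumes F: "F \<in> Hminus S" and G: "G \<in> Hminus S" and zero: "0 \<in> Hplus S" "norm_plus S 0 \<le> 1"
  shows "norm_minus S (\<lambda>u. F u + d * G u) \<le> norm_minus S F + cmod d * norm_minus S G"
proof -
  have "cmod (F u + d * G u) \<le> norm_minus S F + cmod d * norm_minus S G"
    if "u \<in> Hplus S" "norm_plus S u \<le> 1" for u
  proof -
    have "cmod (F u + d * G u) \<le> cmod (F u) + cmod d * cmod (G u)"
      using norm_triangle_ineq[of "F u" "d * G u"] by (simp add: norm_mult)
    also have "\<dots> \<le> norm_minus S F + cmod d * norm_minus S G"
      using norm_minus_upper[OF F that] norm_minus_upper[OF G that] by (intro add_mono mult_left_mono) auto
    finally show ?thesis .
  qed
  then show ?thesis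
    unfolding norm_minus_def[of S "\<lambda>u. F u + d * G u"] by (intro cSUP_least) (use zero in auto)
qed

lemma ops_plus_minusD:
  assumes "B \<in> ops_plus_minus S"
  shows "f \<in> Hplus S \<Longrightarrow> B f \<in> Hminus S"
    and "f \<in> Hplus S \<Longrightarrow> g \<in> Hplus S \<Longrightarrow> B (f + g) u = B f u + B g u"
    and "f \<in> Hplus S \<Longrightarrow> B (c *\<^sub>C f) u = c * B f u"
  using assms by (auto simp: ops_plus_minus_def)

lemma ops_C_minus_eq:
  assumes "K \<in> ops_C_minus S"
  shows "K c u = c * K 1 u"
  by (subst adjoint_K_eq[OF assms]) (simp add: adjoint_K_def)

lemma ops_plus_minus_perturbation:
  assumes B: "B \<in> ops_plus_minus S" and K: "K \<in> ops_C_minus S" "adjoint_K K \<in> ops_plus_C S"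
    and zero: "0 \<in> Hplus S" "norm_plus S 0 \<le> 1"
  shows "(\<lambda>f u. B f u + d * K (adjoint_K K f) u) \<in> ops_plus_minus S"
  unfolding ops_plus_minus_def
proof (intro CollectI conjI ballI allI)
  note BD = ops_plus_minusD[OF B]
  have KH: "K c \<in> Hminus S" for c using K(1) by (simp add: ops_C_minus_def)
  have adj: "f \<in> Hplus S \<Longrightarrow> g \<in> Hplus S \<Longrightarrow> adjoint_K K (f + g) = adjoint_K K f + adjoint_K K g"
    "f \<in> Hplus S \<Longrightarrow> adjoint_K K (c *\<^sub>C f) = c * adjoint_K K f" for f g c
    using K(2) by (simp_all add: ops_plus_C_def)
  note KE = ops_C_minus_eq[OF K(1)]
  show "(\<lambda>u. B f u + d * K (adjoint_K K f) u) \<in> Hminus S" if "f \<in> Hplus S" for f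
    using Hminus_combination[OF BD(1)[OF that] KH] .
  show "(\<lambda>u. B (f + g) u + d * K (adjoint_K K (f + g)) u)
      = (\<lambda>u. (B f u + d * K (adjoint_K K f) u) + (B g u + d * K (adjoint_K K g) u))"
    if "f \<in> Hplus S" "g \<in> Hplus S" for f g
    unfolding KE[of "adjoint_K K _"] using that by (simp add: BD(2) adj algebra_simps)
  show "(\<lambda>u. B (c *\<^sub>C f) u + d * K (adjoint_K K (c *\<^sub>C f)) u)
      = (\<lambda>u. c * (B f u + d * K (adjoint_K K f) u))" if "f \<in> Hplus S" for c f
    unfolding KE[of "adjoint_K K _"] using that by (simp add: BD(3) adj algebra_simps)
  obtain C1 where C1: "\<And>f. f \<in> Hplus S \<Longrightarrow> norm_minus S (B f) \<le> C1 * norm_plus S f"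
    using B unfolding ops_plus_minus_def by blast
  obtain C2 where C2: "\<And>c. norm_minus S (K c) \<le> C2 * cmod c"
    using K(1) unfolding ops_C_minus_def by blast
  obtain C3 where C3: "\<And>f. f \<in> Hplus S \<Longrightarrow> cmod (adjoint_K K f) \<le> C3 * norm_plus S f"
    using K(2) unfolding ops_plus_C_def by blast
  show "\<exists>C. \<forall>f\<in>Hplus S. norm_minus S (\<lambda>u. B f u + d * K (adjoint_K K f) u) \<le> C * norm_plus S f"
  proof (intro exI ballI)
    fix f assume f: "f \<in> Hplus S"
    have 1: "norm_minus S (\<lambda>u. B f u + d * K (adjoint_K K f) u)
        \<le> norm_minus S (B f) + cmod d * norm_minus S (K (adjoint_K K f))"
      by (rule norm_minus_combination[OF BD(1)[OF f] KH zero])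
    have 2: "norm_minus S (K (adjoint_K K f)) \<le> \<bar>C2\<bar> * (C3 * norm_plus S f)"
    proof -
      have "C2 * cmod (adjoint_K K f) \<le> \<bar>C2\<bar> * cmod (adjoint_K K f)" by (intro mult_right_mono) auto
      also have "\<dots> \<le> \<bar>C2\<bar> * (C3 * norm_plus S f)" using C3[OF f] by (intro mult_left_mono) auto
      finally show ?thesis using C2 order_trans by blast
    qed
    have "norm_minus S (\<lambda>u. B f u + d * K (adjoint_K K f) u)
        \<le> C1 * norm_plus S f + cmod d * (\<bar>C2\<bar> * (C3 * norm_plus S f))"
      by (rule order_trans[OF 1 add_mono[OF C1[OF f] mult_left_mono[OF 2]]]) simp
    then show "norm_minus S (\<lambda>u. B f u + d * K (adjoint_K K f) u)
        \<le> (C1 + cmod d * (\<bar>C2\<bar> * C3)) * norm_plus S f"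
      by (simp add: algebra_simps)
  qed
qed

locale lsystem = boundary_pair S A gp gm
  for S A :: "'a::complex_hilbert graph" and gp gm :: 'a +
  fixes \<A> :: "'a \<Rightarrow> 'a functional" and K :: "complex \<Rightarrow> 'a functional"
  assumes L_system: "L_system S \<A> K" and A_eq: "A = quasi_kernel S (Re_pm S \<A>)"
begin

abbreviation B where "B \<equiv> Re_pm S \<A>"

lemma A_pm: "\<A> \<in> ops_plus_minus S" and biext: "t_self_adjoint_biext S B"
  and K_pm: "K \<in> ops_C_minus S" "adjoint_K K \<in> ops_plus_C S"
  and Im_eq: "f \<in> Hplus S \<Longrightarrow> Im_pm S \<A> f = K (adjoint_K K f)"
  using L_system by (auto simp: L_system_def star_extension_def)

lemma B_pm: "B \<in> ops_plus_minus S"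
  and B_hermitian: "f \<in> Hplus S \<Longrightarrow> u \<in> Hplus S \<Longrightarrow> B f u = cnj (B u f)"
proof -
  show "B \<in> ops_plus_minus S" using biext by (simp add: t_self_adjoint_biext_def)
  assume f: "f \<in> Hplus S" and u: "u \<in> Hplus S"
  have "adjoint_pm S B f = B f" using biext f by (simp add: t_self_adjoint_biext_def)
  then have "B f u = adjoint_pm S B f u" by simp
  also have "\<dots> = cnj (B u f)" using u by (simp add: adjoint_pm_def[of S B])
  finally show "B f u = cnj (B u f)" .
qed

lemmas B_Hminus = ops_plus_minusD(1)[OF B_pm]
  and B_add = ops_plus_minusD(2)[OF B_pm]
  and B_scale = ops_plus_minusD(3)[OF B_pm]

lemma B_diff: "f \<in> Hplus S \<Longrightarrow> g \<in> Hplus S \<Longrightarrow> B (f - g) u = B f u - B g u"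
  using B_add[of "f - g" g u] Hplus_diff by simp

lemma K_Hminus: "K c \<in> Hminus S"
  using K_pm(1) by (simp add: ops_C_minus_def)

lemmas K_eq = ops_C_minus_eq[OF K_pm(1)]

lemma A_B: "(f, h) \<in> A \<longleftrightarrow> f \<in> Hplus S \<and> B f = embed S h"
  by (simp add: A_eq quasi_kernel_def)

lemma B_of_A: "(f, h) \<in> A \<Longrightarrow> u \<in> Hplus S \<Longrightarrow> B f u = cinner h u"
  by (simp add: A_B embed_def)

lemma Im_pm_eq: "f \<in> Hplus S \<Longrightarrow> Im_pm S \<A> f u = cnj (K 1 f) * K 1 u"
  by (subst Im_eq, assumption, subst K_eq) (simp add: adjoint_K_def)

lemma A_decomposition: "\<A> f u = B f u + \<i> * Im_pm S \<A> f u"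
  by (simp add: Re_pm_def Im_pm_def field_simps)

text \<open>Up to a factor, \<open>\<eta>\<close> is the functional \<open>K 1\<close>; \<open>B\<close> differs from the adjoint of \<open>S\<close>
  by a rank one form with range \<open>\<eta>\<close>.\<close>

definition \<eta> :: "'a functional" where
  "\<eta> u = B gp u - cinner (\<i> *\<^sub>C gp) u"

definition \<rho> :: real where
  "\<rho> = Re (B gp gp)"

lemma \<eta>_add: "u \<in> Hplus S \<Longrightarrow> v \<in> Hplus S \<Longrightarrow> \<eta> (u + v) = \<eta> u + \<eta> v"
  and \<eta>_scale: "u \<in> Hplus S \<Longrightarrow> \<eta> (c *\<^sub>C u) = cnj c * \<eta> u"
  using HminusD[OF B_Hminus[OF gp_Hplus]] by (simp_all add: \<eta>_def cinner_simps algebra_simps)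

lemma \<eta>_A: "(u, k) \<in> A \<Longrightarrow> \<eta> u = cinner gp k - \<i> * cinner gp u"
  using B_hermitian[OF gp_Hplus, of u] B_of_A[OF _ gp_Hplus, of u k] A_Hplus
  by (simp add: \<eta>_def cnj_cinner cinner_simps)

lemma \<eta>_S: "(u, k) \<in> S \<Longrightarrow> \<eta> u = 0"
  using \<eta>_A[of u k] S_A adjoint_op_cnjD[OF gp, of u k] by (auto simp: cinner_simps)

lemma \<eta>_gp: "\<eta> gp = of_real \<rho> - \<i>"
proof -
  have "B gp gp \<in> \<real>" using B_hermitian[OF gp_Hplus gp_Hplus] by (metis Reals_cnj_iff)
  then show ?thesis by (simp add: \<eta>_def \<rho>_def cinner_simps)
qed

lemma \<eta>_gm: "\<eta> gm = of_real \<rho> + \<i>"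
proof -
  have "\<eta> (gp - gm) = - 2 * \<i>" using \<eta>_A[OF e] by (simp add: cinner_simps algebra_simps)
  moreover have "\<eta> gp = \<eta> (gp - gm) + \<eta> gm"
    using \<eta>_add[of "gp - gm" gm] Hplus_diff gp_Hplus gm_Hplus by simp
  ultimately show ?thesis by (simp add: \<eta>_gp algebra_simps)
qed

lemma \<eta>_gp_nonzero: "\<eta> gp \<noteq> 0"
  by (simp add: \<eta>_gp complex_eq_iff)

lemma \<eta>_coordinates:
  assumes "(f0, h0) \<in> S"
  shows "\<eta> (f0 + a *\<^sub>C gp + b *\<^sub>C gm) = cnj a * (of_real \<rho> - \<i>) + cnj b * (of_real \<rho> + \<i>)"
  using assms by (simp add: \<eta>_add \<eta>_scale \<eta>_gp \<eta>_gm \<eta>_S Hplus_add Hplus_scale S_Hplus gp_Hplus gm_Hplus)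

lemma B_coordinates:
  assumes S: "(f0, h0) \<in> S" and u: "u \<in> Hplus S"
  shows "B (f0 + a *\<^sub>C gp + b *\<^sub>C gm) u
    = cinner (h0 + (\<i> * a) *\<^sub>C gp - (\<i> * b) *\<^sub>C gm) u + (a + b) * \<eta> u"
proof -
  have 1: "B gm u = cinner (- \<i> *\<^sub>C gm) u + \<eta> u"
    using B_of_A[OF e u] B_diff[OF gp_Hplus gm_Hplus, of u]
    by (simp add: \<eta>_def cinner_simps algebra_simps)
  have 2: "B gp u = cinner (\<i> *\<^sub>C gp) u + \<eta> u" by (simp add: \<eta>_def)
  have 3: "B f0 u = cinner h0 u" using B_of_A[OF _ u] S S_A by blast
  have "B (f0 + a *\<^sub>C gp + b *\<^sub>C gm) u = B f0 u + a * B gp u + b * B gm u"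
    using S by (simp add: B_add B_scale Hplus_add Hplus_scale S_Hplus gp_Hplus gm_Hplus)
  then show ?thesis unfolding 1 2 3 by (simp add: cinner_simps algebra_simps)
qed

lemma B_defect:
  assumes z: "Im z \<noteq> 0" and u: "u \<in> Hplus S"
  shows "B (defect gp z) u = z * cinner (defect gp z) u + \<eta> u"
proof -
  have "B gp u - B (defect gp z) u = B (gp - defect gp z) u"
    by (rule B_diff[OF gp_Hplus HplusI[OF defect_adj[OF z]], symmetric])
  also have "\<dots> = cinner (\<i> *\<^sub>C gp) u - z * cinner (defect gp z) u"
    using B_of_A[OF defect_diff[OF z] u] by (simp add: cinner_simps)
  finally have "B gp u = B (defect gp z) u + (cinner (\<i> *\<^sub>C gp) u - z * cinner (defect gp z) u)"
    by (simp only: diff_eq_eq add.commute)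
  then show ?thesis by (simp add: \<eta>_def)
qed

lemma cnj_\<eta>_defect:
  assumes z: "Im z \<noteq> 0"
  shows "cnj (\<eta> (defect gp z)) = of_real \<rho> + weyl gp z"
proof -
  have "cnj (\<eta> (defect gp z)) = B (defect gp z) gp + \<i> * cinner (defect gp z) gp"
    using B_hermitian[OF gp_Hplus HplusI[OF defect_adj[OF z]]]
    by (simp add: \<eta>_def cinner_simps cnj_cinner)
  then show ?thesis using B_defect[OF z gp_Hplus]
    by (simp add: \<eta>_gp weyl_def algebra_simps)
qed

lemma impedance_eq:
  assumes z: "z \<in> upper_half_plane"
    and Re: "Re_pm S \<A>' = B" and K': "K' \<in> ops_C_minus S" "\<And>u. u \<in> Hplus S \<Longrightarrow> K' 1 u = \<tau> * \<eta> u"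
  shows "impedance S \<A>' K' z = of_real ((cmod \<tau>)\<^sup>2) * (of_real \<rho> + weyl gp z)"
proof -
  have z: "Im z \<noteq> 0" using z by (simp add: upper_half_plane_def)
  define g where "g = \<tau> *\<^sub>C defect gp z"
  have g: "g \<in> Hplus S" unfolding g_def by (rule Hplus_scale[OF HplusI[OF defect_adj[OF z]]])
  have K'H: "K' 1 \<in> Hminus S" using K'(1) by (simp add: ops_C_minus_def)
  have sol: "B g u = z * cinner g u + K' 1 u" if "u \<in> Hplus S" for u
    using that B_defect[OF z that]
    by (simp add: g_def B_scale HplusI[OF defect_adj[OF z]] cinner_simps K' algebra_simps)
  have "the_inv_into (Hplus S) (\<lambda>f u. Re_pm S \<A>' f u - z * embed S f u) (K' 1) = g"
    unfolding the_inv_into_def Re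
  proof (rule the_equality)
    have "B g u - z * embed S g u = K' 1 u" for u
      using sol[of u] HminusD(3)[OF B_Hminus[OF g], of u] HminusD(3)[OF K'H, of u]
      by (cases "u \<in> Hplus S") (simp_all add: embed_def)
    then show "g \<in> Hplus S \<and> (\<lambda>u. B g u - z * embed S g u) = K' 1" using g by simp
  next
    fix f assume f: "f \<in> Hplus S \<and> (\<lambda>u. B f u - z * embed S f u) = K' 1"
    have fu: "B f u - z * embed S f u = K' 1 u" for u using f by (metis (no_types))
    have "B (f - g) u = cinner (z *\<^sub>C (f - g)) u" if "u \<in> Hplus S" for u
    proof -
      have "B f u = z * cinner f u + K' 1 u" using fu[of u] that by (simp add: embed_def algebra_simps)
      then show ?thesis using sol[OF that] f g
        by (simp only: B_diff) (simp add: cinner_simps algebra_simps)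
    qed
    moreover have fg: "f - g \<in> Hplus S" using f g Hplus_diff by blast
    ultimately have "B (f - g) = embed S (z *\<^sub>C (f - g))"
      using HminusD(3)[OF B_Hminus[OF fg]] by (auto simp: embed_def fun_eq_iff)
    then have "(f - g, z *\<^sub>C (f - g)) \<in> A" using fg A_B[of "f - g"] by simp
    from lower_bound[OF this z] show "f = g" using z by (simp add: mult_le_0_iff)
  qed
  then have "impedance S \<A>' K' z = cnj (\<tau> * \<eta> g)"
    by (simp add: impedance_def adjoint_K_def K'(2)[OF g])
  also have "\<dots> = \<tau> * cnj \<tau> * cnj (\<eta> (defect gp z))"
    by (simp add: g_def \<eta>_scale HplusI[OF defect_adj[OF z]])
  also have "\<tau> * cnj \<tau> = of_real ((cmod \<tau>)\<^sup>2)" by (rule complex_norm_square[symmetric])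
  finally show ?thesis by (simp add: cnj_\<eta>_defect[OF z])
qed

lemma main_operator_parameter:
  assumes S_T: "S \<subseteq> main_operator S \<A>" and v: "gp - c *\<^sub>C gm \<in> Domain (main_operator S \<A>)" and c: "c \<noteq> 1"
  obtains \<tau> where "\<tau> \<noteq> 0" and "\<And>u. u \<in> Hplus S \<Longrightarrow> K 1 u = \<tau> * \<eta> u"
    and "1 - c = of_real ((cmod \<tau>)\<^sup>2) * (1 + c - \<i> * of_real \<rho> * (1 - c))"
proof -
  define w where "w = gp - c *\<^sub>C gm"
  define \<psi> where "\<psi> = K 1"
  have A_form: "\<A> f u = B f u + \<i> * (cnj (\<psi> f) * \<psi> u)" if "f \<in> Hplus S" for f u
    using A_decomposition[of f u] Im_pm_eq[OF that, of u] by (simp add: \<psi>_def)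
  have \<psi>_S: "\<psi> u = 0" if "(u, k) \<in> S" for u k
  proof -
    have uT: "(u, k) \<in> main_operator S \<A>" and uA: "(u, k) \<in> A" using that S_T S_A by blast+
    then have "\<A> u u = B u u" unfolding A_B by (simp add: main_operator_def)
    then have "cnj (\<psi> u) * \<psi> u = 0" using A_form[OF S_Hplus[OF that], of u] by simp
    then show ?thesis by simp
  qed
  obtain h where h: "(w, h) \<in> main_operator S \<A>" using v unfolding w_def by blast
  then have w: "w \<in> Hplus S" and Aw: "\<A> w = embed S h" by (simp_all add: main_operator_def)
  have w_eq: "w = 0 + 1 *\<^sub>C gp + (- c) *\<^sub>C gm" by (simp add: w_def)
  define k where "k = 0 + (\<i> * 1) *\<^sub>C gp - (\<i> * (- c)) *\<^sub>C gm"
  have Bw: "B w u = cinner k u + (1 - c) * \<eta> u" if "u \<in> Hplus S" for u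
    using B_coordinates[OF linear_opD(2)[OF S_linear] that, of 1 "- c"] unfolding w_eq k_def by simp
  have eq: "cinner h u = cinner k u + (1 - c) * \<eta> u + \<i> * (cnj (\<psi> w) * \<psi> u)" if "u \<in> Hplus S" for u
    using A_form[OF w, of u] Bw[OF that] Aw that by (simp add: embed_def)
  have "h = k"
    by (rule cinner_eq_on_dense[OF S_dense]) (use eq \<eta>_S \<psi>_S S_Hplus in force)
  then have rel: "(1 - c) * \<eta> u = - \<i> * cnj (\<psi> w) * \<psi> u" if "u \<in> Hplus S" for u
    using eq[OF that] by (simp add: eq_neg_iff_add_eq_0 mult.assoc)
  have nz: "\<psi> w \<noteq> 0"
    using rel[OF gp_Hplus] c \<eta>_gp_nonzero by auto
  define \<tau> where "\<tau> = \<i> * (1 - c) / cnj (\<psi> w)"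
  have \<tau>: "\<psi> u = \<tau> * \<eta> u" if "u \<in> Hplus S" for u
  proof -
    have "\<i> * ((1 - c) * \<eta> u) = cnj (\<psi> w) * \<psi> u" unfolding rel[OF that] by (simp flip: mult.assoc)
    then show ?thesis using nz by (simp add: \<tau>_def field_simps)
  qed
  have "(1 - c) * \<eta> gp = - \<i> * cnj (\<tau> * \<eta> w) * (\<tau> * \<eta> gp)"
    using rel[OF gp_Hplus] unfolding \<tau>[OF w] \<tau>[OF gp_Hplus] .
  then have "(1 - c) * \<eta> gp = (- \<i> * (\<tau> * cnj \<tau>) * cnj (\<eta> w)) * \<eta> gp" by (simp add: mult_ac)
  then have "1 - c = - \<i> * (\<tau> * cnj \<tau>) * cnj (\<eta> w)"
    using \<eta>_gp_nonzero mult_right_cancel by blast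
  moreover have "cnj (\<eta> w) = (of_real \<rho> + \<i>) - c * (of_real \<rho> - \<i>)"
    unfolding w_eq using \<eta>_coordinates[OF linear_opD(2)[OF S_linear], of 1 "- c"] by simp
  ultimately have "1 - c = \<tau> * cnj \<tau> * (1 + c - \<i> * of_real \<rho> * (1 - c))"
    by (simp add: algebra_simps)
  then have "1 - c = of_real ((cmod \<tau>)\<^sup>2) * (1 + c - \<i> * of_real \<rho> * (1 - c))"
    by (simp only: complex_norm_square)
  moreover have "\<tau> \<noteq> 0" using nz c by (simp add: \<tau>_def)
  ultimately show ?thesis using that[of \<tau>] \<tau> by (simp add: \<psi>_def)
qed

lemma norm_plus_zero: "norm_plus S 0 = 0"
  using op_apply_eq[OF adj_linear linear_opD(2)[OF adj_linear]]
  by (simp add: norm_plus_def cinner_plus_def)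

text \<open>With the same real part, the imaginary part of the operator is rescaled to
  \<open>(\<cdot>, \<eta>) \<eta>\<close>, which yields \<^term>\<open>T0\<close> as main operator.\<close>

lemma Theta0:
  assumes \<tau>: "\<tau> \<noteq> 0" "\<And>u. u \<in> Hplus S \<Longrightarrow> K 1 u = \<tau> * \<eta> u" and \<rho>: "\<rho> = 0"
  obtains A0 K0 \<sigma> where "L_system S A0 K0" and "Re_pm S A0 = B" and "main_operator S A0 = T0"
    and "K0 \<in> ops_C_minus S" and "cmod \<sigma> = 1" and "\<And>u. u \<in> Hplus S \<Longrightarrow> K0 1 u = \<sigma> * \<eta> u"
proof -
  define s where "s = (cmod \<tau>)\<^sup>2"
  have s: "0 < s" using \<tau>(1) by (simp add: s_def)
  have s_eq: "complex_of_real s = \<tau> * cnj \<tau>" unfolding s_def by (rule complex_norm_square)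
  define A0 where "A0 = (\<lambda>f u. \<A> f u + \<i> * of_real (1 / s - 1) * K (adjoint_K K f) u)"
  define K0 where "K0 = (\<lambda>c. K (c / of_real (sqrt s)))"
  define \<sigma> where "\<sigma> = \<tau> / of_real (sqrt s)"
  have \<sigma>: "cmod \<sigma> = 1" using \<tau>(1) by (simp add: \<sigma>_def norm_divide s_def)
  have A0_pm: "A0 \<in> ops_plus_minus S"
    unfolding A0_def by (rule ops_plus_minus_perturbation[OF A_pm K_pm zero_Hplus]) (simp add: norm_plus_zero)
  have KK: "K (adjoint_K K f) u = cnj (K 1 f) * K 1 u" for f u
    by (subst K_eq) (simp add: adjoint_K_def)
  have off: "F u = 0" if "F \<in> Hminus S" "u \<notin> Hplus S" for F u
    using HminusD(3) that by blast
  have A0_off: "A0 f u = \<A> f u" if "f \<notin> Hplus S" for f u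
    using off[OF K_Hminus that] by (simp add: A0_def KK)
  have A0_on: "A0 f u = B f u + \<i> * (cnj (\<eta> f) * \<eta> u)" if f: "f \<in> Hplus S" and u: "u \<in> Hplus S" for f u
  proof -
    have "A0 f u = B f u + \<i> * (of_real (1 / s) * (cnj (K 1 f) * K 1 u))"
      using A_decomposition[of f u] by (simp add: A0_def KK Im_pm_eq[OF f] algebra_simps)
    also have "of_real (1 / s) * (cnj (K 1 f) * K 1 u) = of_real (1 / s) * (\<tau> * cnj \<tau>) * (cnj (\<eta> f) * \<eta> u)"
      by (simp add: \<tau>(2) f u)
    also have "of_real (1 / s) * (\<tau> * cnj \<tau>) = 1"
      unfolding s_eq[symmetric] using s by (simp flip: of_real_mult)
    finally show ?thesis by simp
  qed
  have adj_on: "adjoint_pm S A0 f u = B f u - \<i> * (cnj (\<eta> f) * \<eta> u)" if "f \<in> Hplus S" "u \<in> Hplus S" for f u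
    using that B_hermitian[OF that] by (simp add: adjoint_pm_def A0_on)
  have Re_A0: "Re_pm S A0 = B"
  proof (intro ext)
    fix f u
    consider "f \<in> Hplus S" "u \<in> Hplus S" | "f \<in> Hplus S" "u \<notin> Hplus S" | "f \<notin> Hplus S" by blast
    then show "Re_pm S A0 f u = B f u"
    proof cases
      case 1
      then show ?thesis by (simp add: Re_pm_def[of S A0] A0_on adj_on)
    next
      case 2
      then show ?thesis
        using off[OF ops_plus_minusD(1)[OF A0_pm]] off[OF B_Hminus]
        by (simp add: Re_pm_def[of S A0] adjoint_pm_def)
    next
      case 3
      then have "adjoint_pm S A0 f u = adjoint_pm S \<A> f u"
        using off[OF ops_plus_minusD(1)[OF A0_pm]] off[OF ops_plus_minusD(1)[OF A_pm]]
        by (simp add: adjoint_pm_def)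
      then show ?thesis by (simp add: Re_pm_def A0_off[OF 3])
    qed
  qed
  have K0_eq: "K0 c u = c * (K 1 u / of_real (sqrt s))" for c u
    unfolding K0_def by (subst K_eq) simp
  have K0_1: "K0 1 u = \<sigma> * \<eta> u" if "u \<in> Hplus S" for u
    by (simp add: K0_eq \<tau>(2)[OF that] \<sigma>_def)
  have Im_A0: "Im_pm S A0 f = K0 (adjoint_K K0 f)" if f: "f \<in> Hplus S" for f
  proof
    fix u
    have eq: "K0 (adjoint_K K0 f) u = cnj (K0 1 f) * K0 1 u"
      unfolding adjoint_K_def K0_eq[of "cnj _"] by (simp add: K0_eq)
    show "Im_pm S A0 f u = K0 (adjoint_K K0 f) u"
    proof (cases "u \<in> Hplus S")
      case True
      have "cnj (K0 1 f) * K0 1 u = (\<sigma> * cnj \<sigma>) * (cnj (\<eta> f) * \<eta> u)"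
        by (simp add: K0_1 True f)
      also have "\<sigma> * cnj \<sigma> = 1" using \<sigma> complex_norm_square[of \<sigma>] by simp
      finally show ?thesis
        unfolding eq by (simp add: Im_pm_def A0_on[OF f True] adj_on[OF f True])
    next
      case False
      then show ?thesis
        unfolding eq using off[OF ops_plus_minusD(1)[OF A0_pm f] False] off[OF K_Hminus False]
        by (simp add: Im_pm_def adjoint_pm_def K0_eq)
    qed
  qed
  have coord: "A0 f u = cinner h u + 2 * b * \<eta> u" "adjoint_pm S A0 f u = cinner h u + 2 * a * \<eta> u"
    if S: "(f0, h0) \<in> S" and u: "u \<in> Hplus S" and f: "f = f0 + a *\<^sub>C gp + b *\<^sub>C gm"
      and h: "h = h0 + (\<i> * a) *\<^sub>C gp - (\<i> * b) *\<^sub>C gm" for f h f0 h0 a b u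
  proof -
    have fH: "f \<in> Hplus S"
      unfolding f using S by (intro Hplus_add Hplus_scale gp_Hplus gm_Hplus S_Hplus)
    have 1: "cnj (\<eta> f) = \<i> * a - \<i> * b"
      unfolding f \<eta>_coordinates[OF S] by (simp add: \<rho> algebra_simps)
    have 2: "B f u = cinner h u + (a + b) * \<eta> u"
      unfolding f h by (rule B_coordinates[OF S u])
    show "A0 f u = cinner h u + 2 * b * \<eta> u" "adjoint_pm S A0 f u = cinner h u + 2 * a * \<eta> u"
      unfolding A0_on[OF fH u] adj_on[OF fH u] 1 2 by (simp_all add: algebra_simps)
  qed
  have embedI: "F = embed S h" if "F \<in> Hminus S" "\<And>u. u \<in> Hplus S \<Longrightarrow> F u = cinner h u" for F h
    using that off[OF that(1)] by (auto simp: embed_def fun_eq_iff)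
  have T0: "f \<in> Hplus S \<and> A0 f = embed S h" if fh: "(f, h) \<in> T0" for f h
  proof -
    have f: "f \<in> Hplus S" using fh T0_adj HplusI by blast
    obtain f0 h0 a where f0: "(f0, h0) \<in> S" and *: "f = f0 + a *\<^sub>C gp" "h = h0 + (\<i> * a) *\<^sub>C gp"
      using fh unfolding T0_def by blast
    have "A0 f u = cinner h u" if "u \<in> Hplus S" for u
      using coord(1)[OF f0 that, of f a 0 h] * by simp
    with f show ?thesis using embedI[OF ops_plus_minusD(1)[OF A0_pm f]] by blast
  qed
  have adj_T0: "f \<in> Hplus S \<and> adjoint_pm S A0 f = embed S h" if fh: "(f, h) \<in> adjoint_op T0" for f h
  proof -
    have fh': "(f, h) \<in> adjoint_op S" using fh adj_T0_adj by blast
    then have f: "f \<in> Hplus S" by (rule HplusI)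
    obtain f0 h0 a b where f0: "(f0, h0) \<in> S" and *: "f = f0 + a *\<^sub>C gp + b *\<^sub>C gm"
      "h = h0 + (\<i> * a) *\<^sub>C gp - (\<i> * b) *\<^sub>C gm"
      using decomposition[OF fh'] .
    have "a = 0" by (rule adj_T0_coordinate[OF fh f0 *])
    then have "adjoint_pm S A0 f u = cinner h u" if "u \<in> Hplus S" for u
      using coord(2)[OF f0 that *] by simp
    then show ?thesis using f by (auto simp: embed_def adjoint_pm_def fun_eq_iff)
  qed
  have main: "main_operator S A0 = T0"
  proof (intro equalityI subrelI)
    fix f h assume "(f, h) \<in> T0"
    then show "(f, h) \<in> main_operator S A0" using T0 by (simp add: main_operator_def)
  next
    fix f h assume "(f, h) \<in> main_operator S A0"
    then have f: "f \<in> Hplus S" and fh: "A0 f = embed S h" by (simp_all add: main_operator_def)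
    obtain k where k: "(f, k) \<in> adjoint_op S" using f unfolding Hplus_iff by blast
    obtain f0 h0 a b where f0: "(f0, h0) \<in> S" and *: "f = f0 + a *\<^sub>C gp + b *\<^sub>C gm"
      "k = h0 + (\<i> * a) *\<^sub>C gp - (\<i> * b) *\<^sub>C gm"
      using decomposition[OF k] .
    have eq: "cinner h u = cinner k u + 2 * b * \<eta> u" if "u \<in> Hplus S" for u
      using coord(1)[OF f0 that *] fh that by (simp add: embed_def)
    have "h = k"
      by (rule cinner_eq_on_dense[OF S_dense]) (use eq \<eta>_S S_Hplus in force)
    then have "b = 0" using eq[OF gp_Hplus] \<eta>_gp_nonzero by simp
    then show "(f, h) \<in> T0" using T0I[OF f0, of a] * \<open>h = k\<close> by simp
  qed
  have "star_extension S T0 A0"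
    unfolding star_extension_def extends_to_def Re_A0
    by (intro conjI A0_pm S_T0 S_adj_T0 biext ballI) (use T0 adj_T0 in auto)
  moreover have K0_pm: "K0 \<in> ops_C_minus S"
    unfolding ops_C_minus_def
  proof (intro CollectI conjI allI)
    show "K0 c \<in> Hminus S" for c unfolding K0_def by (rule K_Hminus)
    show "K0 (c + d) = (\<lambda>u. K0 c u + K0 d u)" for c d
      by (simp add: fun_eq_iff K0_eq[of "c + d"] K0_eq[of c] K0_eq[of d] algebra_simps add_divide_distrib)
    show "K0 (c * d) = (\<lambda>u. c * K0 d u)" for c d
      by (simp add: fun_eq_iff K0_eq[of "c * d"] K0_eq[of d])
    obtain C where C: "\<And>c. norm_minus S (K c) \<le> C * cmod c"
      using K_pm(1) unfolding ops_C_minus_def by blast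
    have "norm_minus S (K0 c) \<le> C / sqrt s * cmod c" for c
      using C[of "c / of_real (sqrt s)"] s by (simp add: K0_def norm_divide)
    then show "\<exists>C. \<forall>c. norm_minus S (K0 c) \<le> C * cmod c" by blast
  qed
  moreover have "adjoint_K K0 \<in> ops_plus_C S"
  proof -
    have eq: "adjoint_K K0 f = adjoint_K K f / of_real (sqrt s)" for f
      by (simp add: adjoint_K_def K0_eq)
    obtain C where C: "\<And>f. f \<in> Hplus S \<Longrightarrow> cmod (adjoint_K K f) \<le> C * norm_plus S f"
      using K_pm(2) unfolding ops_plus_C_def by blast
    have "cmod (adjoint_K K0 f) \<le> C / sqrt s * norm_plus S f" if "f \<in> Hplus S" for f
      using C[OF that] s by (simp add: eq norm_divide divide_right_mono)
    then have "\<exists>C. \<forall>f \<in> Hplus S. cmod (adjoint_K K0 f) \<le> C * norm_plus S f" by blast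
    then show ?thesis
      using K_pm(2) unfolding ops_plus_C_def by (simp add: eq add_divide_distrib)
  qed
  moreover have "range K0 = Im_pm S A0 ` Hplus S"
  proof (intro equalityI subsetI)
    fix F assume "F \<in> Im_pm S A0 ` Hplus S"
    then show "F \<in> range K0" using Im_A0 by auto
  next
    fix F assume "F \<in> range K0"
    then obtain c where F: "F = K0 c" by blast
    define d where "d = cnj (K0 1 gp)"
    have d: "d \<noteq> 0"
      using \<sigma> \<eta>_gp_nonzero K0_1[OF gp_Hplus] unfolding d_def by auto
    have "adjoint_K K0 ((c / d) *\<^sub>C gp) = c"
      using d \<eta>_scale[OF gp_Hplus] unfolding adjoint_K_def
      by (simp add: K0_1 Hplus_scale gp_Hplus d_def)
    then have "F = Im_pm S A0 ((c / d) *\<^sub>C gp)"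
      using Im_A0[OF Hplus_scale[OF gp_Hplus]] F by simp
    then show "F \<in> Im_pm S A0 ` Hplus S" using Hplus_scale[OF gp_Hplus] by blast
  qed
  ultimately have "L_system S A0 K0"
    unfolding L_system_def using T0_Lambda Im_A0 by blast
  then show ?thesis using that Re_A0 main K0_pm \<sigma> K0_1 by blast
qed

end

lemma exists_boundary_pair:
  assumes S: "closed_symmetric S" and deficiency: "deficiency_one_one S"
    and pair: "deficiency_pair S gp gm" and A: "self_adjoint A" and S_A: "S \<subseteq> A"
  obtains \<theta> where "cmod \<theta> = 1" and "gp - \<theta> *\<^sub>C gm \<in> Domain A"
proof -
  have lin: "linear_op A" and adj: "adjoint_op A = A" using A by (simp_all add: self_adjoint_iff)
  have gp: "(gp, \<i> *\<^sub>C gp) \<in> adjoint_op S" and norm: "norm gp = 1" "norm gm = 1"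
    using pair by (auto simp: deficiency_pair_def eigenspace_def)
  have real: "Im (cinner h f) = 0" if "(f, h) \<in> A" for f h
    using symmetric_real[of A] adj that by blast
  have "A \<noteq> S"
  proof
    assume "A = S"
    then have "Im (cinner (\<i> *\<^sub>C gp) gp) = 0" using real gp adj by auto
    then show False by (simp add: cinner_simps cinner_self norm)
  qed
  then obtain f h where fh: "(f, h) \<in> A" "(f, h) \<notin> S" using S_A by auto
  have "(f, h) \<in> adjoint_op S" using fh(1) adjoint_op_antimono[OF S_A] adj by blast
  then obtain f0 h0 a b where f0: "(f0, h0) \<in> S" and f: "f = f0 + a *\<^sub>C gp + b *\<^sub>C gm"
    and h: "h = h0 + (\<i> * a) *\<^sub>C gp - (\<i> * b) *\<^sub>C gm"
    using von_neumann_decomposition[OF S deficiency pair] by blast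
  define x where "x = a *\<^sub>C gp + b *\<^sub>C gm"
  define y where "y = (\<i> * a) *\<^sub>C gp - (\<i> * b) *\<^sub>C gm"
  have "(f - f0, h - h0) \<in> A" using linear_opD(5)[OF lin fh(1)] f0 S_A by blast
  moreover have "f - f0 = x" "h - h0 = y" by (simp_all add: f h x_def y_def)
  ultimately have xy: "(x, y) \<in> A" by simp
  define c where "c = \<i> * a * cnj b * cinner gp gm"
  have "cnj c = - \<i> * b * cnj a * cinner gm gp" by (simp add: c_def cnj_cinner)
  then have "cinner y x = \<i> * of_real ((cmod a)\<^sup>2) - \<i> * of_real ((cmod b)\<^sup>2) + (c + cnj c)"
    unfolding x_def y_def complex_norm_square c_def
    by (simp add: cinner_simps cinner_self norm algebra_simps)
  then have "(cmod a)\<^sup>2 = (cmod b)\<^sup>2" using real[OF xy] by simp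
  then have ab: "cmod a = cmod b" by simp
  have "a \<noteq> 0"
  proof
    assume "a = 0"
    then have "b = 0" using ab by simp
    with \<open>a = 0\<close> show False using fh(2) f0 by (simp add: f h)
  qed
  have "(1 / a) *\<^sub>C x = gp - (- b / a) *\<^sub>C gm"
    using \<open>a \<noteq> 0\<close> by (simp add: x_def scaleC_add_right)
  then have "gp - (- b / a) *\<^sub>C gm \<in> Domain A"
    using linear_opD(4)[OF lin xy, of "1 / a"] by auto
  moreover have "cmod (- b / a) = 1" using \<open>a \<noteq> 0\<close> by (simp add: norm_divide flip: ab)
  ultimately show ?thesis using that by blast
qed

theorem theorem12:
  fixes S T Ahat :: "'a::complex_hilbert graph"
    and \<A> :: "'a \<Rightarrow> 'a functional"
    and K :: "complex \<Rightarrow> 'a functional"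
    and \<kappa> :: real
  assumes "0 < \<kappa>" and "\<kappa> < 1"
    and "closed_symmetric S" and "deficiency_one_one S"
    and "L_system S \<A> K" and "prime_op S"
    and "T = main_operator S \<A>" and "von_neumann_parameter S T \<kappa>"
    and "\<not> (\<exists>c. \<forall>z \<in> upper_half_plane. impedance S \<A> K z = c)"
    and "Ahat = quasi_kernel S (Re_pm S \<A>)"
  shows
    "(impedance S \<A> K \<in> donoghue_class \<kappa> \<and>
      (\<exists>\<A>0 K0. L_system S \<A>0 K0 \<and>
        quasi_kernel S (Re_pm S \<A>0) = Ahat \<and>
        hypothesis_H S (main_operator S \<A>0) Ahat 0 \<and>
        (\<forall>z \<in> upper_half_plane.
          impedance S \<A> K z = complex_of_real ((1 - \<kappa>) / (1 + \<kappa>)) * impedance S \<A>0 K0 z)))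
     \<longleftrightarrow> hypothesis_H S T Ahat \<kappa>"
proof -
  define r where "r = (1 - \<kappa>) / (1 + \<kappa>)"
  have r: "0 < r" "1 - \<kappa> = r * (1 + \<kappa>)" using assms(1,2) by (simp_all add: r_def)
  have "t_self_adjoint_biext S (Re_pm S \<A>)"
    using assms(5) by (auto simp: L_system_def star_extension_def)
  then have A: "self_adjoint Ahat" and S_A: "S \<subseteq> Ahat"
    unfolding t_self_adjoint_biext_def assms(10) extends_to_def quasi_kernel_def by auto
  have T: "T \<noteq> adjoint_op T" "max_dissipative_ext S T"
    using assms(8) by (simp_all add: von_neumann_parameter_def)
  then have S_T: "S \<subseteq> T" by (simp add: max_dissipative_ext_def)
  have i_UHP: "\<i> \<in> upper_half_plane" by (simp add: upper_half_plane_def)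
  have lsystemI: "lsystem S Ahat gp gm \<A> K" if "deficiency_pair S gp gm" "gp - gm \<in> Domain Ahat" for gp gm
    by unfold_locales (use assms A S_A that in auto)
  show ?thesis (is "?V \<and> ?\<Theta> \<longleftrightarrow> ?H")
  proof
    assume "?V \<and> ?\<Theta>"
    then have V: "impedance S \<A> K \<i> = \<i> * of_real r"
      using donoghue_class_ii assms(1,2) by (simp add: r_def)
    obtain gp gm0 where pair0: "deficiency_pair S gp gm0"
      and v: "gp - complex_of_real \<kappa> *\<^sub>C gm0 \<in> Domain T"
      using assms(8) by (auto simp: von_neumann_parameter_def)
    obtain \<theta> where \<theta>: "cmod \<theta> = 1" "gp - \<theta> *\<^sub>C gm0 \<in> Domain Ahat"
      using exists_boundary_pair[OF assms(3,4) pair0 A S_A] .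
    define gm where "gm = \<theta> *\<^sub>C gm0"
    define c where "c = of_real \<kappa> / \<theta>"
    have "linear_op (adjoint_op S)" using linear_op_adjoint assms(3) by (auto simp: closed_symmetric_def)
    then have "gm \<in> eigenspace (adjoint_op S) (- \<i>)"
      using pair0 complex_vector.subspace_scale[OF subspace_eigenspace]
      by (auto simp: gm_def deficiency_pair_def)
    then have pair: "deficiency_pair S gp gm"
      using pair0 \<theta>(1) by (simp add: deficiency_pair_def gm_def norm_scaleC)
    interpret lsystem S Ahat gp gm \<A> K
      using lsystemI pair \<theta>(2) by (simp add: gm_def)
    have "\<theta> \<noteq> 0" using \<theta>(1) by auto
    then have v': "gp - c *\<^sub>C gm \<in> Domain T" using v by (simp add: c_def gm_def)
    have "cmod c = \<kappa>" using \<theta>(1) assms(1) by (simp add: c_def norm_divide)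
    then have "c \<noteq> 1" using assms(2) by auto
    obtain \<tau> where \<tau>: "\<tau> \<noteq> 0" "\<And>u. u \<in> Hplus S \<Longrightarrow> K 1 u = \<tau> * \<eta> u"
      and eq: "1 - c = of_real ((cmod \<tau>)\<^sup>2) * (1 + c - \<i> * of_real \<rho> * (1 - c))"
      using main_operator_parameter[of c] S_T v' \<open>c \<noteq> 1\<close> unfolding assms(7) by blast
    have "impedance S \<A> K \<i> = of_real ((cmod \<tau>)\<^sup>2) * (of_real \<rho> + weyl gp \<i>)"
      by (rule impedance_eq[OF i_UHP refl K_pm(1) \<tau>(2)])
    then have *: "\<i> * of_real r = of_real ((cmod \<tau>)\<^sup>2) * (of_real \<rho> + \<i>)"
      unfolding V by (simp add: weyl_ii)
    have "Re (\<i> * of_real r) = (cmod \<tau>)\<^sup>2 * \<rho>" "Im (\<i> * of_real r) = (cmod \<tau>)\<^sup>2"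
      unfolding * by simp_all
    then have "\<rho> = 0" "(cmod \<tau>)\<^sup>2 = r" using \<tau>(1) by simp_all
    then have "1 - c = of_real r * (1 + c)" using eq by simp
    then have "(1 + of_real \<kappa>) * (1 - c) = (1 + of_real \<kappa>) * of_real r * (1 + c)" by simp
    also have "(1 + of_real \<kappa>) * of_real r = complex_of_real (1 - \<kappa>)"
      unfolding r(2) by simp
    finally have "c = of_real \<kappa>" by (simp add: algebra_simps)
    then show ?H
      unfolding hypothesis_H_def using T S_A A pair e_A v' by blast
  next
    assume H: ?H
    then obtain gp gm where pair: "deficiency_pair S gp gm" "gp - gm \<in> Domain Ahat"
      and v: "gp - complex_of_real \<kappa> *\<^sub>C gm \<in> Domain T"
      by (auto simp: hypothesis_H_def)
    interpret lsystem S Ahat gp gm \<A> K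
      using lsystemI pair by blast
    have "complex_of_real \<kappa> \<noteq> 1" using assms(2) by (metis of_real_eq_1_iff less_irrefl)
    then obtain \<tau> where \<tau>: "\<tau> \<noteq> 0" "\<And>u. u \<in> Hplus S \<Longrightarrow> K 1 u = \<tau> * \<eta> u"
      and eq: "1 - complex_of_real \<kappa> = of_real ((cmod \<tau>)\<^sup>2) * (1 + of_real \<kappa> - \<i> * of_real \<rho> * (1 - of_real \<kappa>))"
      using main_operator_parameter[of "of_real \<kappa>"] S_T v \<open>complex_of_real \<kappa> \<noteq> 1\<close>
      unfolding assms(7) by blast
    have "Re (1 - complex_of_real \<kappa>) = (cmod \<tau>)\<^sup>2 * (1 + \<kappa>)"
      "Im (1 - complex_of_real \<kappa>) = - ((cmod \<tau>)\<^sup>2 * (\<rho> * (1 - \<kappa>)))"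
      by (subst eq, simp del: of_real_power)+
    then have \<rho>: "\<rho> = 0" and "(cmod \<tau>)\<^sup>2 * (1 + \<kappa>) = 1 - \<kappa>" using \<tau>(1) assms(1,2) by auto
    then have s: "(cmod \<tau>)\<^sup>2 = r" using assms(1) by (simp add: r_def field_simps)
    have V: "impedance S \<A> K z = of_real r * weyl gp z" if "z \<in> upper_half_plane" for z
      using impedance_eq[OF that refl K_pm(1) \<tau>(2)] by (simp add: \<rho> s)
    have ?V
      using weyl_donoghue[OF norm_gp S_densely S_A gp _ _ V[unfolded r_def]] assms(1,2) by simp
    moreover obtain A0 K0 \<sigma> where \<Theta>0: "L_system S A0 K0" "Re_pm S A0 = B" "main_operator S A0 = T0"
      and K0: "K0 \<in> ops_C_minus S" "cmod \<sigma> = 1" "\<And>u. u \<in> Hplus S \<Longrightarrow> K0 1 u = \<sigma> * \<eta> u"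
      using Theta0[OF \<tau> \<rho>] by blast
    have "impedance S A0 K0 z = weyl gp z" if "z \<in> upper_half_plane" for z
      using impedance_eq[OF that \<Theta>0(2) K0(1,3)] by (simp add: \<rho> K0(2))
    then have ?\<Theta>
      using \<Theta>0 T0_hypothesis_H V by (intro exI[of _ A0] exI[of _ K0]) (simp add: r_def assms(10))
    ultimately show "?V \<and> ?\<Theta>" by blast
  qed
qed

end
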